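(* Let $m\geqslant 3$ be an odd integer. Then the number of distinct $C_4$-face-magic projective labelings on $\mathcal{P}_{m,m}$, counted up to symmetries of the projective plane, is at least $\tau(m,m)\,2^{m-3}\Bigl(\bigl((\tfrac{m-1}{2})!\bigr)^2+2\bigl(\beta(m)\bigr)^2\Bigr)$.
   Context: $\mathcal{P}_{m,n}$ has vertices $(i,j)$, $1\leqslant i\leqslant m$, $1\leqslant j\leqslant n$, and edges $(i,j)$–$(i,j+1)$ ($j\leqslant n-1$), $(i,n)$–$(m+1-i,1)$, $(i,j)$–$(i+1,j)$ ($i\leqslant m-1$), $(m,j)$–$(1,n+1-j)$, embedded naturally in the projective plane. Its 4-cycle faces are $\{(i,j),(i+1,j),(i,j+1),(i+1,j+1)\}$ ($1\leqslant i\leqslant m-1$, $1\leqslant j\leqslant n-1$), $\{(i,n),(i+1,n),(m+1-i,1),(m-i,1)\}$ ($1\leqslant i\leqslant m-1$), $\{(m,j),(m,j+1),(1,n+1-j),(1,n-j)\}$ ($1\leqslant j\leqslant n-1$); the other two faces are digons. A $C_4$-face-magic projective labeling is a bijection from the vertices onto $\{1,\ldots,mn\}$ such that every 4-cycle face has the same label sum. For $\mathcal{P}_{m,m}$ the symmetries are the 8 elements of the dihedral group generated by the rotation $(i,j)\mapsto(m+1-j,i)$ and the reflection $(i,j)\mapsto(i,m+1-j)$; labelings are counted up to precomposition with these. For positive integer $k$, an $(m,n)$-projective factorization sequence is a tuple $(m_1,n_1,\ldots,m_k,n_k)$ of integers $>1$ with $m=m_1\cdots m_k$, $n=n_1\cdots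 n_k$, or a tuple $(m_1,n_1,\ldots,m_k,n_k,m_{k+1})$ of integers $>1$ with $m=m_1\cdots m_{k+1}$, $n=n_1\cdots n_k$; $\tau(m,n)$ is the number of distinct such sequences. For odd $m\geqslant3$, $\beta(m)=\bigl((\tfrac{m-1}{4})!\bigr)^2$ if $m\equiv1\pmod4$ and $\beta(m)=(\tfrac{m-3}{4})!\,(\tfrac{m+1}{4})!$ if $m\equiv3\pmod4$. *)

theory Defs
  imports "HOL-Algebra.Bij" "HOL-Algebra.Generated_Groups"
begin

definition proj_vertices :: "nat \<Rightarrow> nat \<Rightarrow> (nat \<times> nat) set" where
  "proj_vertices m n = {1..m} \<times> {1..n}"

text \<open>Only the 4-cycle faces of the projective grid; the two digonal faces carry no condition.\<close>

definition proj_C4_faces :: "nat \<Rightarrow> nat \<Rightarrow> (nat \<times> nat) set set" where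
  "proj_C4_faces m n =
     {{(i, j), (i + 1, j), (i, j + 1), (i + 1, j + 1)} | i j.
        1 \<le> i \<and> i \<le> m - 1 \<and> 1 \<le> j \<and> j \<le> n - 1}
   \<union> {{(i, n), (i + 1, n), (m + 1 - i, 1), (m - i, 1)} | i. 1 \<le> i \<and> i \<le> m - 1}
   \<union> {{(m, j), (m, j + 1), (1, n + 1 - j), (1, n - j)} | j. 1 \<le> j \<and> j \<le> n - 1}"

text \<open>Labelings are extensional, so that distinct labelings differ at some vertex.\<close>

definition C4_face_magic_labelings :: "nat \<Rightarrow> nat \<Rightarrow> (nat \<times> nat \<Rightarrow> nat) set" where
  "C4_face_magic_labelings m n =
     {f \<in> extensional (proj_vertices m n).
        bij_betw f (proj_vertices m n) {1..m * n} \<and>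
        (\<exists>S. \<forall>F \<in> proj_C4_faces m n. (\<Sum>v\<in>F. f v) = S)}"

definition square_rotation :: "nat \<Rightarrow> nat \<times> nat \<Rightarrow> nat \<times> nat" where
  "square_rotation m = (\<lambda>(i, j) \<in> proj_vertices m m. (m + 1 - j, i))"

definition square_reflection :: "nat \<Rightarrow> nat \<times> nat \<Rightarrow> nat \<times> nat" where
  "square_reflection m = (\<lambda>(i, j) \<in> proj_vertices m m. (i, m + 1 - j))"

definition square_symmetries :: "nat \<Rightarrow> (nat \<times> nat \<Rightarrow> nat \<times> nat) set" where
  "square_symmetries m =
     generate (BijGroup (proj_vertices m m)) {square_rotation m, square_reflection m}"

definition labeling_equiv ::
    "nat \<Rightarrow> ((nat \<times> nat \<Rightarrow> nat) \<times> (nat \<times> nat \<Rightarrow> nat)) set" where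
  "labeling_equiv m =
     {(f, g). f \<in> C4_face_magic_labelings m m \<and> g \<in> C4_face_magic_labelings m m \<and>
        (\<exists>s \<in> square_symmetries m. g = compose (proj_vertices m m) f s)}"

definition num_labelings_up_to_symmetry :: "nat \<Rightarrow> nat" where
  "num_labelings_up_to_symmetry m = card (C4_face_magic_labelings m m // labeling_equiv m)"

text \<open>A sequence \<open>(m\<^sub>1, n\<^sub>1, m\<^sub>2, n\<^sub>2, \<dots>)\<close> is a list: \<open>m\<^sub>i\<close> and \<open>n\<^sub>i\<close> have
  (zero-based) positions \<open>2 * (i - 1)\<close> and \<open>2 * (i - 1) + 1\<close>.\<close>

definition proj_factorization_seqs :: "nat \<Rightarrow> nat \<Rightarrow> nat list set" where
  "proj_factorization_seqs m n =
     {xs. (\<forall>x \<in> set xs. x > 1) \<and>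
        (\<exists>k \<ge> 1.
           length xs = 2 * k \<and>
             m = (\<Prod>i<k. xs ! (2 * i)) \<and> n = (\<Prod>i<k. xs ! (2 * i + 1))
         \<or> length xs = 2 * k + 1 \<and>
             m = (\<Prod>i<k + 1. xs ! (2 * i)) \<and> n = (\<Prod>i<k. xs ! (2 * i + 1)))}"

definition tau :: "nat \<Rightarrow> nat \<Rightarrow> nat" where
  "tau m n = card (proj_factorization_seqs m n)"

text \<open>Meant for odd \<open>m \<ge> 3\<close>, where all divisions are exact.\<close>

definition beta :: "nat \<Rightarrow> nat" where
  "beta m = (if m mod 4 = 1 then (fact ((m - 1) div 4))\<^sup>2
             else fact ((m - 3) div 4) * fact ((m + 1) div 4))"

end

theory Submission
  imports Defs
begin

text \<open>
  Put the origin at the central vertex, so that rows and columns are indexed by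
  \<open>D = {-h..h}\<close> with \<open>m = 2h + 1\<close>. If \<open>\<alpha>\<close> and \<open>\<beta>\<close> are odd functions on \<open>D\<close>, then every labeling
  whose value at \<open>(d, e)\<close> is \<open>p + w (\<alpha> d + \<beta> e)\<close> or \<open>q - w (\<alpha> d + \<beta> e)\<close>, according to the parity
  of \<open>d + e\<close>, has constant face sum \<open>2 (p + q)\<close>: on an inner face the four variable parts cancel,
  on a wrap-around face antipodal vertices cancel.

  Let \<open>N = (m\<^sup>2 - 1) / 2\<close> and let \<open>A\<close>, \<open>B\<close> be symmetric integer sets with \<open>m\<close> elements each and
  \<open>A \<oplus> B = {-N..N}\<close>. Any odd bijections \<open>\<alpha> : D \<rightarrow> A\<close>, \<open>\<beta> : D \<rightarrow> B\<close> yield the labeling with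
  \<open>p = q = N + 1\<close>, \<open>w = 1\<close>; antipodal vertices carry opposite values \<open>\<plusminus>v\<close>, so the parity-dependent
  sign only permutes labels. If \<open>\<alpha>\<close> and \<open>\<beta>\<close> preserve parity, then with \<open>w = 1/2\<close> the even and the
  odd sums can instead be sent to the lower and the upper half of \<open>{1..m\<^sup>2}\<close>, or vice versa. The
  parity classes of \<open>D\<close> and \<open>A\<close> have equal sizes because the sum of \<open>(-1)\<^sup>a\<close> over \<open>A\<close> divides the
  corresponding sum over \<open>{-N..N}\<close>, which is \<open>\<plusminus>1\<close>; this is the source of \<open>\<beta>(m)\<close>.

  A factorization sequence \<open>x\<^sub>1, x\<^sub>2, \<dots>\<close> gives a pair of tiles by writing integers in the mixed radix
  \<open>x\<^sub>1, x\<^sub>2, \<dots>\<close> with centered digits and letting \<open>A\<close> use the digits in odd, \<open>B\<close> those in even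
  positions. Exchanging the tiles gives \<open>2 \<tau>(m, m)\<close> pairs. Finally, a symmetry class has at most
  8 elements.
\<close>

section \<open>Symmetry classes\<close>

text \<open>The eight elements of the dihedral group as signed permutations of the coordinates:
  \<open>t\<close> transposes first, then \<open>a\<close> and \<open>b\<close> reverse the
  resulting first and second coordinate.\<close>

definition square_symmetry :: "nat \<Rightarrow> bool \<times> bool \<times> bool \<Rightarrow> nat \<times> nat \<Rightarrow> nat \<times> nat" where
  "square_symmetry m = (\<lambda>(t, a, b). \<lambda>(i, j) \<in> proj_vertices m m.
     (if a then m + 1 - (if t then j else i) else (if t then j else i),
      if b then m + 1 - (if t then i else j) else (if t then i else j)))"

text \<open>The map on the right acts first. Carrying its reversals past a transposition exchanges
  them, as in a semidirect product.\<close>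

lemma compose_square_symmetry:
  "compose (proj_vertices m m) (square_symmetry m (t, a, b)) (square_symmetry m (t', a', b')) =
     square_symmetry m (t \<noteq> t', a \<noteq> (if t then b' else a'), b \<noteq> (if t then a' else b'))"
  by (rule ext) (auto simp: square_symmetry_def compose_def proj_vertices_def)

lemma square_symmetry_id:
  "square_symmetry m (False, False, False) = (\<lambda>v \<in> proj_vertices m m. v)"
  by (rule ext) (auto simp: square_symmetry_def proj_vertices_def)

lemma square_symmetry_mapsto:
  "square_symmetry m s \<in> proj_vertices m m \<rightarrow> proj_vertices m m"
  by (cases s) (auto simp: square_symmetry_def proj_vertices_def)

lemma square_symmetry_Bij: "square_symmetry m s \<in> Bij (proj_vertices m m)"
proof (cases s)
  case (fields t a b)
  let ?V = "proj_vertices m m"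
  \<comment> \<open>The inverse: the same transposition, with the two reversals exchanged when
    \<open>t\<close> holds.\<close>
  let ?r = "square_symmetry m (t, if t then b else a, if t then a else b)"
  have "compose ?V ?r (square_symmetry m s) = (\<lambda>v\<in>?V. v)"
    "compose ?V (square_symmetry m s) ?r = (\<lambda>v\<in>?V. v)"
    by (simp_all add: fields compose_square_symmetry square_symmetry_id)
  hence "\<And>v. v \<in> ?V \<Longrightarrow> ?r (square_symmetry m s v) = v"
    "\<And>v. v \<in> ?V \<Longrightarrow> square_symmetry m s (?r v) = v"
    by (metis compose_eq restrict_apply')+
  hence "bij_betw (square_symmetry m s) ?V ?V"
    using square_symmetry_mapsto by (intro bij_betwI[where g = ?r]) auto
  thus ?thesis
    by (simp add: Bij_def square_symmetry_def fields)
qed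

text \<open>The eight maps contain the identity, both generators and their inverses, and are closed
  under composition. This bounds the number of labelings equivalent to a given one.\<close>

lemma square_symmetries_subset: "square_symmetries m \<subseteq> range (square_symmetry m)"
proof
  let ?V = "proj_vertices m m" and ?G = "BijGroup (proj_vertices m m)"
  interpret G: group ?G
    by (rule group_BijGroup)
  have carr: "square_symmetry m s \<in> carrier ?G" for s
    by (simp add: BijGroup_def square_symmetry_Bij)
  have mult: "square_symmetry m s \<otimes>\<^bsub>?G\<^esub> square_symmetry m s' =
      compose ?V (square_symmetry m s) (square_symmetry m s')" for s s'
    by (simp add: BijGroup_def square_symmetry_Bij)
  have one: "\<one>\<^bsub>?G\<^esub> = square_symmetry m (False, False, False)"
    by (simp add: square_symmetry_id BijGroup_def)
  have rot: "square_rotation m = square_symmetry m (True, True, False)"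
    by (rule ext) (auto simp: square_rotation_def square_symmetry_def)
  have refl: "square_reflection m = square_symmetry m (False, False, True)"
    by (rule ext) (auto simp: square_reflection_def square_symmetry_def)
  have "inv\<^bsub>?G\<^esub> (square_rotation m) = square_symmetry m (True, False, True)"
    unfolding rot by (rule G.inv_equality) (auto simp: carr mult one compose_square_symmetry)
  moreover have "inv\<^bsub>?G\<^esub> (square_reflection m) = square_symmetry m (False, False, True)"
    unfolding refl by (rule G.inv_equality) (auto simp: carr mult one compose_square_symmetry)
  ultimately have inv: "inv\<^bsub>?G\<^esub> s \<in> range (square_symmetry m)"
    if "s \<in> {square_rotation m, square_reflection m}" for s
    using that by auto
  fix s
  assume "s \<in> square_symmetries m"
  hence "s \<in> generate ?G {square_rotation m, square_reflection m}"
    by (simp add: square_symmetries_def)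
  thus "s \<in> range (square_symmetry m)"
  proof induction
    case (eng s1 s2)
    then obtain u1 u2 where "s1 = square_symmetry m u1" "s2 = square_symmetry m u2"
      by blast
    thus ?case
      by (cases u1; cases u2) (simp add: mult compose_square_symmetry)
  qed (use one rot refl inv in auto)
qed

lemma finite_C4_face_magic_labelings: "finite (C4_face_magic_labelings m n)"
proof (rule finite_subset)
  show "C4_face_magic_labelings m n \<subseteq> proj_vertices m n \<rightarrow>\<^sub>E {1..m * n}"
    by (auto simp: C4_face_magic_labelings_def PiE_def dest: bij_betw_imp_funcset)
  show "finite (proj_vertices m n \<rightarrow>\<^sub>E {1..m * n})"
    by (intro finite_PiE) (auto simp: proj_vertices_def)
qed

text \<open>Reflexivity makes the classes cover all labelings, and every class is contained in the
  image of the eight symmetries.\<close>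

lemma card_labelings_le:
  "card (C4_face_magic_labelings m m) \<le> 8 * num_labelings_up_to_symmetry m"
proof -
  let ?L = "C4_face_magic_labelings m m" and ?V = "proj_vertices m m" and ?R = "labeling_equiv m"
  have class_le: "card (?R `` {f}) \<le> 8" for f
  proof -
    have "?R `` {f} \<subseteq> (\<lambda>s. compose ?V f (square_symmetry m s)) ` UNIV"
      using square_symmetries_subset[of m] by (fastforce simp: labeling_equiv_def)
    hence "card (?R `` {f}) \<le> card (UNIV :: (bool \<times> bool \<times> bool) set)"
      by (meson card_image_le card_mono finite finite_imageI order_trans)
    also have "\<dots> = 8"
      by (simp add: card_UNIV_bool flip: UNIV_Times_UNIV)
    finally show ?thesis .
  qed
  have refl: "f \<in> ?R `` {f}" if "f \<in> ?L" for f
  proof -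
    have "(\<lambda>v\<in>?V. v) \<in> square_symmetries m"
      using generate.one[of "BijGroup ?V"] by (simp add: square_symmetries_def BijGroup_def)
    \<comment> \<open>This uses that labelings are extensional: \<open>compose\<close> is undefined
      outside the vertex set.\<close>
    moreover have "f = compose ?V f (\<lambda>v\<in>?V. v)"
      using that by (intro compose_Id[symmetric, where B = UNIV])
        (auto simp: C4_face_magic_labelings_def)
    ultimately show ?thesis
      using that unfolding labeling_equiv_def by blast
  qed
  have "?L \<subseteq> \<Union> (?L // ?R)"
    using refl by (blast intro: quotientI)
  moreover have "finite (\<Union> (?L // ?R))"
    by (rule finite_subset[OF _ finite_C4_face_magic_labelings[of m m]])
      (auto simp: quotient_def labeling_equiv_def)
  ultimately have "card ?L \<le> card (\<Union> (?L // ?R))"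
    by (rule card_mono[rotated])
  also have "\<dots> \<le> (\<Sum>C\<in>?L // ?R. card C)"
    by (rule card_Union_le_sum_card)
  also have "\<dots> \<le> (\<Sum>C\<in>?L // ?R. 8)"
    by (rule sum_mono) (auto simp: quotient_def class_le)
  finally show ?thesis
    by (simp add: num_labelings_up_to_symmetry_def)
qed

section \<open>Odd bijections between symmetric sets\<close>

definition bijections :: "'a set \<Rightarrow> 'b set \<Rightarrow> ('a \<Rightarrow> 'b) set" where
  "bijections S T = {f \<in> S \<rightarrow>\<^sub>E T. bij_betw f S T}"

lemma card_bijections:
  assumes "finite S" "finite T" "card S = card T"
  shows "card (bijections S T) = fact (card T)"
proof -
  have "bijections S T = {f \<in> S \<rightarrow>\<^sub>E T. inj_on f S}"
  proof (intro equalityI subsetI)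
    fix f
    assume f: "f \<in> {f \<in> S \<rightarrow>\<^sub>E T. inj_on f S}"
    hence "f ` S = T"
      using assms by (intro card_subset_eq) (auto simp: card_image)
    with f show "f \<in> bijections S T"
      by (simp add: bijections_def bij_betw_def)
  qed (auto simp: bijections_def bij_betw_def)
  thus ?thesis
    using card_inj_on_subset_funcset[OF assms(1,2) order_refl] assms(3) by (simp add: fact_prod_rev)
qed

lemma finite_bijections: "finite S \<Longrightarrow> finite T \<Longrightarrow> finite (bijections S T)"
  by (rule finite_subset[of _ "S \<rightarrow>\<^sub>E T"]) (auto simp: bijections_def intro: finite_PiE)

section \<open>Symmetric sets of integers and their parity classes\<close>

definition symmetric_set :: "int set \<Rightarrow> bool" where
  "symmetric_set A \<longleftrightarrow> (\<forall>a\<in>A. - a \<in> A)"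

definition pos_part :: "int set \<Rightarrow> int set" where
  "pos_part A = {a \<in> A. 0 < a}"

definition parity_sign :: "int \<Rightarrow> int" where
  "parity_sign a = (if even a then 1 else - 1)"

lemma parity_sign_add: "parity_sign (a + b) = parity_sign a * parity_sign b"
  by (simp add: parity_sign_def)

text \<open>The set splits into its zero, its positive part and the mirror image of the latter. The
  cases of interest are \<open>f = 1\<close> and \<open>f = parity_sign\<close>.\<close>

lemma sum_symmetric_set:
  fixes f :: "int \<Rightarrow> int"
  assumes "finite A" "symmetric_set A" "\<And>a. f (- a) = f a"
  shows "sum f A = (if 0 \<in> A then f 0 else 0) + 2 * sum f (pos_part A)"
proof -
  have A: "A = (A \<inter> {0}) \<union> (pos_part A \<union> uminus ` pos_part A)"
  proof -
    have "a = 0 \<or> a \<in> pos_part A \<or> a \<in> uminus ` pos_part A" if "a \<in> A" for a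
      using that assms(2) unfolding symmetric_set_def pos_part_def
      by (cases a "0 :: int" rule: linorder_cases) (auto intro!: image_eqI[of a uminus "- a"])
    moreover have "uminus ` pos_part A \<subseteq> A" "pos_part A \<subseteq> A"
      using assms(2) by (auto simp: symmetric_set_def pos_part_def)
    ultimately show ?thesis
      by blast
  qed
  have fin: "finite (pos_part A)"
    using assms(1) by (simp add: pos_part_def)
  have "sum f A = sum f (A \<inter> {0}) + (sum f (pos_part A) + sum f (uminus ` pos_part A))"
    by (subst (1) A, subst sum.union_disjoint)
      (use assms(1) fin in \<open>auto simp: pos_part_def intro!: sum.union_disjoint\<close>)
  also have "sum f (uminus ` pos_part A) = sum f (pos_part A)"
    by (subst sum.reindex) (auto simp: assms(3))
  also have "sum f (A \<inter> {0}) = (if 0 \<in> A then f 0 else 0)"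
    by (cases "0 \<in> A") auto
  finally show ?thesis
    by simp
qed

lemma odd_symmetric_set:
  assumes "finite A" "symmetric_set A" "odd (card A)"
  shows "0 \<in> A" "card (pos_part A) = (card A - 1) div 2"
proof -
  have "int (card A) = (if 0 \<in> A then 1 else 0) + 2 * int (card (pos_part A))"
    using sum_symmetric_set[OF assms(1,2), of "\<lambda>_. 1"] by (simp cong: if_cong)
  with assms(3) show "0 \<in> A" "card (pos_part A) = (card A - 1) div 2"
    by (auto split: if_splits) presburger+
qed

text \<open>Let e and o count the even and odd positive elements. The signed sum is 1 + 2(e - o), so
  its being 1 or -1 means e = o or e = o - 1. Since e + o is half of \<open>card A - 1\<close>, both
  counts are determined.\<close>

lemma card_parity_pos_part:
  assumes "finite A" "symmetric_set A" "odd (card A)" "\<bar>sum parity_sign A\<bar> = 1"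
  shows "card {a \<in> pos_part A. even a} = (card A - 1) div 2 div 2"
    "card {a \<in> pos_part A. odd a} = ((card A - 1) div 2 + 1) div 2"
proof -
  let ?P = "pos_part A"
  let ?e = "card {a \<in> ?P. even a}" and ?o = "card {a \<in> ?P. odd a}"
  have fin: "finite ?P"
    using assms(1) by (simp add: pos_part_def)
  have P: "?P = {a \<in> ?P. even a} \<union> {a \<in> ?P. odd a}"
    by auto
  have "card ?P = ?e + ?o"
    by (subst P, rule card_Un_disjoint) (use fin in auto)
  moreover have "sum parity_sign ?P = int ?e - int ?o"
    by (subst P, subst sum.union_disjoint) (use fin in \<open>auto simp: parity_sign_def\<close>)
  moreover have "sum parity_sign A = 1 + 2 * sum parity_sign ?P"
    using sum_symmetric_set[OF assms(1,2), of parity_sign] odd_symmetric_set(1)[OF assms(1-3)]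
    by (simp add: parity_sign_def)
  moreover have "card ?P = (card A - 1) div 2"
    by (rule odd_symmetric_set(2)[OF assms(1-3)])
  ultimately show "?e = (card A - 1) div 2 div 2" "?o = ((card A - 1) div 2 + 1) div 2"
    using assms(4) by linarith+
qed

section \<open>Odd bijections from bijections of positive parts and sign choices\<close>

definition odd_bijections :: "int set \<Rightarrow> int set \<Rightarrow> (int \<Rightarrow> int) set" where
  "odd_bijections D A = {f \<in> bijections D A. \<forall>d\<in>D. f (- d) = - f d}"

definition parity_preserving :: "int set \<Rightarrow> (int \<Rightarrow> int) set" where
  "parity_preserving D = {f. \<forall>d\<in>D. even (f d) \<longleftrightarrow> even d}"

text \<open>\<open>p\<close> prescribes absolute values on the positive part, and \<open>S\<close>
  is the set of positive arguments whose value becomes negative. The factor \<open>sgn d\<close>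
  makes the function odd and zero at 0.\<close>

definition odd_extension :: "int set \<Rightarrow> (int \<Rightarrow> int) \<times> int set \<Rightarrow> int \<Rightarrow> int" where
  "odd_extension D = (\<lambda>(p, S). \<lambda>d\<in>D. sgn d * (if \<bar>d\<bar> \<in> S then - p \<bar>d\<bar> else p \<bar>d\<bar>))"

text \<open>The absolute value of the image determines that of the argument because \<open>p\<close>
  is injective, and the sign separates opposite arguments. Equal finite cardinalities turn
  injectivity into bijectivity.\<close>

lemma odd_extension_in:
  assumes "finite D" "symmetric_set D" "0 \<in> D" "finite A" "symmetric_set A" "0 \<in> A"
    and "card D = card A" "p \<in> bijections (pos_part D) (pos_part A)"
  shows "odd_extension D (p, S) \<in> odd_bijections D A"
proof -
  let ?f = "odd_extension D (p, S)"
  have sym: "- d \<in> D \<longleftrightarrow> d \<in> D" for d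
    using assms(2) unfolding symmetric_set_def by force
  have abs_D: "\<bar>d\<bar> \<in> D" if "d \<in> D" for d
    using that sym by (simp add: abs_if)
  have p: "p d \<in> A" "0 < p d" if "d \<in> D" "d > 0" for d
    using assms(8) that by (auto simp: bijections_def pos_part_def)
  have inj: "inj_on p (pos_part D)"
    using assms(8) by (auto simp: bijections_def bij_betw_def)
  have range: "?f \<in> D \<rightarrow> A"
    using p assms(5,6) abs_D
    by (auto simp: odd_extension_def symmetric_set_def sgn_if sym intro!: p) 
  have pabs: "p \<bar>d\<bar> > 0" if "d \<in> D" "d \<noteq> 0" for d
    using p abs_D that by simp
  have abs_f: "\<bar>?f d\<bar> = (if d = 0 then 0 else p \<bar>d\<bar>)" if "d \<in> D" for d
    using pabs[OF that] that by (auto simp: odd_extension_def abs_mult abs_sgn_eq)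
  have odd: "?f (- d) = - ?f d" if "d \<in> D" for d
    using that by (simp add: odd_extension_def sym)
  have "inj_on ?f D"
  proof (rule inj_onI)
    fix d e
    assume d: "d \<in> D" and e: "e \<in> D" and eq: "?f d = ?f e"
    have z: "d = 0 \<longleftrightarrow> e = 0"
      using abs_f[OF d] abs_f[OF e] eq pabs[OF d] pabs[OF e] by (auto split: if_splits)
    show "d = e"
    proof (cases "e = 0")
      case False
      hence "p \<bar>d\<bar> = p \<bar>e\<bar>"
        using abs_f[OF d] abs_f[OF e] eq z by simp
      moreover have "\<bar>d\<bar> \<in> pos_part D" "\<bar>e\<bar> \<in> pos_part D"
        using abs_D[OF d] abs_D[OF e] False z by (simp_all add: pos_part_def)
      ultimately have "\<bar>d\<bar> = \<bar>e\<bar>"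
        by (rule inj_onD[OF inj])
      moreover have "?f (- e) \<noteq> ?f e"
        using odd[OF e] abs_f[OF e] pabs[OF e False] False by (simp split: abs_split)
      hence "d \<noteq> - e"
        using eq by metis
      ultimately show ?thesis
        by linarith
    qed (use z in simp)
  qed
  hence "bij_betw ?f D A"
    unfolding bij_betw_def using range assms(4,7)
    by (metis card_image card_subset_eq image_subset_iff_funcset)
  moreover have "?f \<in> extensional D"
    by (simp add: odd_extension_def)
  ultimately show ?thesis
    using range odd by (auto simp: odd_bijections_def bijections_def PiE_def)
qed

text \<open>Values of \<open>p\<close> are positive, so at a positive argument the absolute value of
  the extension gives \<open>p\<close> and its sign tells membership in \<open>S\<close>.\<close>

lemma inj_on_odd_extension:
  "inj_on (odd_extension D) (bijections (pos_part D) (pos_part A) \<times> Pow (pos_part D))"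
proof (rule inj_onI, clarify)
  fix p S q T
  assume p: "p \<in> bijections (pos_part D) (pos_part A)" and S: "S \<subseteq> pos_part D"
    and q: "q \<in> bijections (pos_part D) (pos_part A)" and T: "T \<subseteq> pos_part D"
    and eq: "odd_extension D (p, S) = odd_extension D (q, T)"
  have *: "p d = q d \<and> (d \<in> S \<longleftrightarrow> d \<in> T)" if d: "d \<in> pos_part D" for d
  proof -
    have "p d > 0" "q d > 0"
      using p q d by (auto simp: bijections_def pos_part_def)
    thus ?thesis
      using fun_cong[OF eq, of d] d by (auto simp: odd_extension_def pos_part_def split: if_splits)
  qed
  have "p = q"
    using p q * by (intro extensionalityI[of _ "pos_part D"]) (auto simp: bijections_def PiE_def)
  thus "p = q \<and> S = T"
    using * S T by blast
qed

lemma card_odd_extension_image: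
  assumes "finite D" "P \<subseteq> bijections (pos_part D) (pos_part A)"
  shows "card (odd_extension D ` (P \<times> Pow (pos_part D))) = card P * 2 ^ card (pos_part D)"
proof -
  have "inj_on (odd_extension D) (P \<times> Pow (pos_part D))"
    by (rule inj_on_subset[OF inj_on_odd_extension]) (use assms(2) in auto)
  thus ?thesis
    using assms(1) by (simp add: card_image card_cartesian_product card_Pow pos_part_def)
qed

lemma finite_odd_bijections: "finite D \<Longrightarrow> finite A \<Longrightarrow> finite (odd_bijections D A)"
  by (rule finite_subset[OF _ finite_bijections[of D A]]) (auto simp: odd_bijections_def)

lemma card_odd_bijections_ge:
  assumes "finite D" "symmetric_set D" "odd (card D)"
    and "finite A" "symmetric_set A" "card A = card D"
  defines "h \<equiv> (card D - 1) div 2"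
  shows "fact h * 2 ^ h \<le> card (odd_bijections D A)"
proof -
  let ?P = "bijections (pos_part D) (pos_part A)"
  have cD: "card (pos_part D) = h" and cA: "card (pos_part A) = h"
    using odd_symmetric_set(2)[OF assms(1-3)] odd_symmetric_set(2)[OF assms(4,5)] assms(3,6)
    by (simp_all add: h_def)
  have z: "0 \<in> D" "0 \<in> A"
    using odd_symmetric_set(1)[OF assms(1-3)] odd_symmetric_set(1)[OF assms(4,5)] assms(3,6)
    by auto
  have "card ?P = fact h"
    using card_bijections[of "pos_part D" "pos_part A"] assms(1,4) cD cA by (simp add: pos_part_def)
  hence "fact h * 2 ^ h = card (odd_extension D ` (?P \<times> Pow (pos_part D)))"
    using card_odd_extension_image[OF assms(1), of ?P A] cD by simp
  also have "\<dots> \<le> card (odd_bijections D A)"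
    using assms(1-6) z by (intro card_mono finite_odd_bijections) (auto intro!: odd_extension_in)
  finally show ?thesis .
qed

lemma card_parity_odd_bijections_ge:
  assumes "finite D" "symmetric_set D" "odd (card D)" "\<bar>sum parity_sign D\<bar> = 1"
    and "finite A" "symmetric_set A" "card A = card D" "\<bar>sum parity_sign A\<bar> = 1"
  defines "h \<equiv> (card D - 1) div 2"
  shows "fact (h div 2) * fact ((h + 1) div 2) * 2 ^ h
    \<le> card (odd_bijections D A \<inter> parity_preserving D)"
proof -
  define DE AE DO AO where "DE = {d \<in> pos_part D. even d}" and "AE = {d \<in> pos_part A. even d}"
    and "DO = {d \<in> pos_part D. odd d}" and "AO = {d \<in> pos_part A. odd d}"
  note defs = DE_def AE_def DO_def AO_def
  \<comment> \<open>Even and odd positive arguments are treated separately.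
    \<open>card_parity_pos_part\<close> makes the parity classes of both positive parts equally
    large, which yields the two factorials.\<close>
  define glue :: "(int \<Rightarrow> int) \<times> (int \<Rightarrow> int) \<Rightarrow> int \<Rightarrow> int" where
    "glue = (\<lambda>(q, r). \<lambda>d\<in>pos_part D. if even d then q d else r d)"
  define Q where "Q = bijections DE AE \<times> bijections DO AO"
  have fin: "finite DE" "finite AE" "finite DO" "finite AO"
    using assms(1,5) by (auto simp: defs pos_part_def)
  have oddA: "odd (card A)"
    using assms(3,7) by simp
  have cards: "card DE = h div 2" "card AE = h div 2"
      "card DO = (h + 1) div 2" "card AO = (h + 1) div 2"
    using card_parity_pos_part[OF assms(1-4)] card_parity_pos_part[OF assms(5,6) oddA assms(8)]
      assms(7) by (simp_all add: defs h_def)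
  have cQ: "card Q = fact (h div 2) * fact ((h + 1) div 2)"
    using fin cards by (simp add: Q_def card_cartesian_product card_bijections)
  have z: "0 \<in> D" "0 \<in> A"
    using odd_symmetric_set(1)[OF assms(1-3)] odd_symmetric_set(1)[OF assms(5,6) oddA] by auto
  have inj: "inj_on glue Q"
  proof (rule inj_onI, clarify)
    fix q r q' r'
    assume *: "(q, r) \<in> Q" "(q', r') \<in> Q" "glue (q, r) = glue (q', r')"
    have eq: "(if even d then q d else r d) = (if even d then q' d else r' d)"
      if "d \<in> pos_part D" for d
      using fun_cong[OF *(3), of d] that by (simp add: glue_def)
    have "q = q'"
    proof (rule extensionalityI[of _ DE])
      show "q d = q' d" if "d \<in> DE" for d
        using eq[of d] that by (auto simp: defs)
    qed (use * in \<open>auto simp: Q_def bijections_def PiE_def\<close>)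
    moreover have "r = r'"
    proof (rule extensionalityI[of _ DO])
      show "r d = r' d" if "d \<in> DO" for d
        using eq[of d] that by (auto simp: defs)
    qed (use * in \<open>auto simp: Q_def bijections_def PiE_def\<close>)
    ultimately show "q = q' \<and> r = r'"
      by simp
  qed
  have glue: "glue (q, r) \<in> bijections (pos_part D) (pos_part A) \<inter> parity_preserving (pos_part D)"
    if "(q, r) \<in> Q" for q r
  proof -
    have D: "pos_part D = DE \<union> DO" and A: "pos_part A = AE \<union> AO"
      by (auto simp: defs)
    have "bij_betw (glue (q, r)) DE AE \<longleftrightarrow> bij_betw q DE AE"
      by (rule bij_betw_cong) (auto simp: glue_def defs)
    moreover have "bij_betw (glue (q, r)) DO AO \<longleftrightarrow> bij_betw r DO AO"
      by (rule bij_betw_cong) (auto simp: glue_def defs)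
    ultimately have b: "bij_betw (glue (q, r)) DE AE" "bij_betw (glue (q, r)) DO AO"
      using that by (auto simp: Q_def bijections_def)
    have "bij_betw (glue (q, r)) (pos_part D) (pos_part A)"
      unfolding D A by (rule bij_betw_combine[OF b]) (auto simp: defs)
    moreover have "glue (q, r) \<in> extensional (pos_part D)"
      by (simp add: glue_def)
    moreover have "glue (q, r) \<in> parity_preserving (pos_part D)"
      using bij_betw_apply[OF b(1)] bij_betw_apply[OF b(2)]
      by (auto simp: parity_preserving_def defs)
    ultimately show ?thesis
      by (auto simp: bijections_def PiE_def dest: bij_betw_imp_funcset)
  qed
  have "odd_extension D (p, S) \<in> odd_bijections D A \<inter> parity_preserving D"
    if "p \<in> glue ` Q" for p S
  proof
    have p: "p \<in> bijections (pos_part D) (pos_part A)" "p \<in> parity_preserving (pos_part D)"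
      using that glue by auto
    show "odd_extension D (p, S) \<in> odd_bijections D A"
      by (rule odd_extension_in) (use assms z p in auto)
    \<comment> \<open>Passing from \<open>d\<close> to its absolute value and changing signs both
      leave parity unchanged.\<close>
    have "\<bar>d\<bar> \<in> pos_part D" if "d \<in> D" "d \<noteq> 0" for d
      using that assms(2) by (auto simp: pos_part_def symmetric_set_def abs_if)
    thus "odd_extension D (p, S) \<in> parity_preserving D"
      using p(2) by (auto simp: parity_preserving_def odd_extension_def sgn_if)
  qed
  hence "odd_extension D ` (glue ` Q \<times> Pow (pos_part D))
      \<subseteq> odd_bijections D A \<inter> parity_preserving D"
    by blast
  moreover have "card (odd_extension D ` (glue ` Q \<times> Pow (pos_part D)))
      = card Q * 2 ^ card (pos_part D)"
  proof -
    have "glue ` Q \<subseteq> bijections (pos_part D) (pos_part A)"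
      using glue by auto
    from card_odd_extension_image[OF assms(1) this] show ?thesis
      by (simp add: card_image[OF inj])
  qed
  ultimately have "card Q * 2 ^ card (pos_part D) \<le> card (odd_bijections D A \<inter> parity_preserving D)"
    using finite_odd_bijections[OF assms(1,5)] by (metis card_mono finite_Int)
  thus ?thesis
    using cQ odd_symmetric_set(2)[OF assms(1-3)] by (simp add: h_def)
qed

section \<open>Symmetric tilings of an interval\<close>

definition centered :: "nat \<Rightarrow> int set" where
  "centered n = {s. 2 * \<bar>s\<bar> < int n}"

lemma centered_odd: "centered (2 * k + 1) = {- int k..int k}"
  by (auto simp: centered_def)

lemma finite_centered: "finite (centered n)"
  by (rule finite_subset[of _ "{- int n..int n}"]) (auto simp: centered_def)

lemma card_centered: "odd n \<Longrightarrow> card (centered n) = n"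
  by (erule oddE) (simp only: centered_odd, simp)

lemma symmetric_centered: "symmetric_set (centered n)"
  by (simp add: symmetric_set_def centered_def)

text \<open>Each new pair of opposite elements contributes twice the negative of the current sum, so
  the sum alternates between 1 and -1.\<close>

lemma sum_parity_sign_centered:
  assumes "odd n"
  shows "\<bar>sum parity_sign (centered n)\<bar> = 1"
proof -
  have "sum parity_sign {- int k..int k} = parity_sign (int k)" for k
  proof (induction k)
    case (Suc k)
    have "{- int (Suc k)..int (Suc k)} = insert (int k + 1) (insert (- int k - 1) {- int k..int k})"
      by auto
    thus ?case
      using Suc by (simp add: parity_sign_def)
  qed (simp add: parity_sign_def)
  thus ?thesis
    using assms by (elim oddE) (simp only: centered_odd, simp add: parity_sign_def)
qed

section \<open>Centered digits and mixed-radix tiles\<close>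

lemma centered_digit_unique:
  assumes "s \<in> centered x" "s' \<in> centered x" "s + int x * t = s' + int x * t'"
  shows "s = s'" "t = t'"
proof -
  have x: "int x > 0"
    using assms(1) by (auto simp: centered_def)
  have eq: "s - s' = int x * (t' - t)"
    using assms(3) by (simp add: algebra_simps)
  moreover have "\<bar>s - s'\<bar> < int x"
    using assms(1,2) by (auto simp: centered_def)
  \<comment> \<open>Two centered digits differ by less than \<open>x\<close>, and here also by a
    multiple of \<open>x\<close>.\<close>
  ultimately have "\<bar>t' - t\<bar> < 1"
    using x by (metis abs_mult abs_of_pos mult.right_neutral mult_less_cancel_left_pos)
  thus "s = s'" "t = t'"
    using eq by auto
qed

lemma centered_digit:
  assumes "odd x" "odd n"
  shows "(\<lambda>(s, t). s + int x * t) ` (centered x \<times> centered n) = centered (x * n)"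
proof (intro equalityI subsetI)
  fix v
  assume "v \<in> (\<lambda>(s, t). s + int x * t) ` (centered x \<times> centered n)"
  then obtain s t where v: "v = s + int x * t" and "2 * \<bar>s\<bar> < int x" "2 * \<bar>t\<bar> < int n"
    by (auto simp: centered_def)
  hence "2 * \<bar>t\<bar> + 1 \<le> int n" 
    by simp
  hence "int x * (2 * \<bar>t\<bar> + 1) \<le> int x * int n"
    by (intro mult_left_mono) auto
  moreover have "\<bar>v\<bar> \<le> \<bar>s\<bar> + int x * \<bar>t\<bar>"
    unfolding v using abs_triangle_ineq[of s "int x * t"] by (simp add: abs_mult)
  ultimately show "v \<in> centered (x * n)"
    using \<open>2 * \<bar>s\<bar> < int x\<close> by (simp add: centered_def algebra_simps)
next
  fix v
  assume v: "v \<in> centered (x * n)"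
  obtain h where h: "x = 2 * h + 1"
    using assms(1) by (elim oddE)
  \<comment> \<open>Shifting by \<open>h\<close> turns the ordinary remainder, between 0 and
    \<open>2 * h\<close>, into a centered one.\<close>
  define t where "t = (v + int h) div int x"
  define s where "s = v - int x * t"
  have "s + int h = (v + int h) mod int x"
    by (simp add: s_def t_def minus_div_mult_eq_mod[symmetric])
  moreover have "0 \<le> (v + int h) mod int x" "(v + int h) mod int x < int x"
    using h by simp_all
  ultimately have "0 \<le> s + int h" "s + int h < int x"
    by simp_all
  hence s: "\<bar>s\<bar> \<le> int h"
    using h by simp
  have "int x * \<bar>t\<bar> = \<bar>v - s\<bar>"
    by (simp add: s_def abs_mult)
  also have "\<dots> \<le> \<bar>v\<bar> + int h"
    using s by linarith
  finally have "int x * (2 * \<bar>t\<bar>) < int x * (int n + 1)"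
    using v h by (simp add: centered_def algebra_simps)
  hence "2 * \<bar>t\<bar> < int n + 1"
    using h by (simp add: mult_less_cancel_left_pos)
  \<comment> \<open>The estimate above is too weak by one; the oddness of \<open>n\<close> closes
    the gap.\<close>
  moreover have "2 * \<bar>t\<bar> \<noteq> int n"
    using assms(2) by presburger
  ultimately have "t \<in> centered n"
    by (simp add: centered_def)
  moreover have "s \<in> centered x"
    using s h by (simp add: centered_def)
  moreover have "v = s + int x * t"
    by (simp add: s_def)
  ultimately show "v \<in> (\<lambda>(s, t). s + int x * t) ` (centered x \<times> centered n)"
    by force
qed

text \<open>The lowest digit belongs to the left tile. After it is removed the roles are exchanged,
  so the mutual recursion distributes the digits alternately.\<close>

fun left_tile :: "nat list \<Rightarrow> int set" and right_tile :: "nat list \<Rightarrow> int set" where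
  "left_tile [] = {0}"
| "right_tile [] = {0}"
| "left_tile (x # xs) = (\<lambda>(s, b). s + int x * b) ` (centered x \<times> right_tile xs)"
| "right_tile (x # xs) = (*) (int x) ` left_tile xs"

lemma odd_prod_list: "\<forall>x\<in>set xs. odd x \<Longrightarrow> odd (prod_list xs :: nat)"
  by (induction xs) auto

text \<open>A sum of elements of the two tiles has the form s + x(a + b), with a digit s and with a
  and b in the tiles of the remaining list. The digit is unique, and a + b is handled by
  induction.\<close>

lemma bij_betw_tiles:
  assumes "\<forall>x\<in>set xs. odd x"
  shows "bij_betw (\<lambda>(a, b). a + b) (left_tile xs \<times> right_tile xs) (centered (prod_list xs))"
  using assms
proof (induction xs)
  case Nil
  show ?case
    by (auto simp: bij_betw_def centered_def)
next
  case (Cons x xs)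
  let ?A = "left_tile xs" and ?B = "right_tile xs"
  have IH: "inj_on (\<lambda>(a, b). a + b) (?A \<times> ?B)"
      "(\<lambda>(a, b). a + b) ` (?A \<times> ?B) = centered (prod_list xs)"
    using Cons by (auto simp: bij_betw_def)
  show ?case
    unfolding bij_betw_def
  proof
    show "inj_on (\<lambda>(a, b). a + b) (left_tile (x # xs) \<times> right_tile (x # xs))"
    proof (rule inj_onI, clarsimp)
      fix s s' a a' b b'
      assume *: "s \<in> centered x" "s' \<in> centered x" "a \<in> ?A" "a' \<in> ?A" "b \<in> ?B" "b' \<in> ?B"
        "s + int x * b + int x * a = s' + int x * b' + int x * a'"
      hence "s + int x * (a + b) = s' + int x * (a' + b')"
        by (simp add: algebra_simps)
      hence "s = s'" "a + b = a' + b'"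
        using centered_digit_unique[OF *(1,2)] by blast+
      with * inj_onD[OF IH(1), of "(a, b)" "(a', b')"]
      show "s + int x * b = s' + int x * b' \<and> (x = 0 \<or> a = a')"
        by auto
    qed
    have "(\<lambda>(a, b). a + b) ` (left_tile (x # xs) \<times> right_tile (x # xs))
        = (\<lambda>(s, t). s + int x * t) ` (centered x \<times> (\<lambda>(a, b). a + b) ` (?A \<times> ?B))"
      (is "?l = ?r")
    proof (intro equalityI subsetI)
      fix v
      assume "v \<in> ?l"
      then obtain s a b where "v = s + int x * b + int x * a" "s \<in> centered x" "a \<in> ?A" "b \<in> ?B"
        by auto
      thus "v \<in> ?r"
        by (intro image_eqI[of _ _ "(s, a + b)"]) (auto simp: algebra_simps intro: image_eqI[of _ _ "(a, b)"])
    next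
      fix v
      assume "v \<in> ?r"
      then obtain s a b where "v = s + int x * (a + b)" "s \<in> centered x" "a \<in> ?A" "b \<in> ?B"
        by auto
      thus "v \<in> ?l"
        by (intro image_eqI[of _ _ "(s + int x * b, int x * a)"])
          (auto simp: algebra_simps intro: image_eqI[of _ _ "(s, b)"])
    qed
    also have "\<dots> = centered (prod_list (x # xs))"
      using centered_digit[of x "prod_list xs"] odd_prod_list[of xs] Cons.prems by (simp add: IH(2))
    finally show "(\<lambda>(a, b). a + b) ` (left_tile (x # xs) \<times> right_tile (x # xs)) =
      centered (prod_list (x # xs))" .
  qed
qed

lemma symmetric_tiles: "symmetric_set (left_tile xs) \<and> symmetric_set (right_tile xs)"
proof (induction xs)
  case (Cons x xs)
  show ?case
    unfolding symmetric_set_def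
  proof (intro conjI ballI)
    fix a
    assume "a \<in> left_tile (x # xs)"
    then obtain s b where "a = s + int x * b" "s \<in> centered x" "b \<in> right_tile xs"
      by auto
    thus "- a \<in> left_tile (x # xs)"
      using Cons symmetric_centered[of x]
      by (auto simp: symmetric_set_def intro!: image_eqI[of _ _ "(- s, - b)"])
  next
    fix b
    assume "b \<in> right_tile (x # xs)"
    then obtain a where "b = int x * a" "a \<in> left_tile xs"
      by auto
    thus "- b \<in> right_tile (x # xs)"
      using Cons by (auto simp: symmetric_set_def intro!: image_eqI[of _ _ "- a"])
  qed
qed (simp add: symmetric_set_def)

text \<open>Removing the head exchanges even and odd zero-based positions, in step with the
  recursion of the tiles. The bounds count the even and the odd positions for either parity of the
  length.\<close>

lemma prod_alternating_Cons:
  fixes x :: nat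
  shows "(\<Prod>i<(length (x # xs) + 1) div 2. (x # xs) ! (2 * i)) =
      x * (\<Prod>i<length xs div 2. xs ! (2 * i + 1))"
    and "(\<Prod>i<length (x # xs) div 2. (x # xs) ! (2 * i + 1)) =
      (\<Prod>i<(length xs + 1) div 2. xs ! (2 * i))"
proof -
  have "(length (x # xs) + 1) div 2 = Suc (length xs div 2)"
    by simp
  thus "(\<Prod>i<(length (x # xs) + 1) div 2. (x # xs) ! (2 * i)) =
      x * (\<Prod>i<length xs div 2. xs ! (2 * i + 1))"
    by (simp only: prod.lessThan_Suc_shift) simp
qed simp

lemma card_tiles:
  assumes "\<forall>x\<in>set xs. odd x"
  shows "card (left_tile xs) = (\<Prod>i<(length xs + 1) div 2. xs ! (2 * i)) \<and>
    card (right_tile xs) = (\<Prod>i<length xs div 2. xs ! (2 * i + 1))"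
  using assms
proof (induction xs)
  case (Cons x xs)
  have "inj_on (\<lambda>(s, b). s + int x * b) (centered x \<times> right_tile xs)"
    by (rule inj_onI, clarsimp) (metis centered_digit_unique)
  hence "card (left_tile (x # xs)) = x * card (right_tile xs)"
    using Cons.prems by (simp add: card_image card_cartesian_product card_centered)
  moreover have "x \<noteq> 0"
    using Cons.prems by (auto intro: Nat.gr0I)
  hence "card (right_tile (x # xs)) = card (left_tile xs)"
    by (simp add: card_image inj_on_def)
  ultimately show ?case
    using Cons unfolding prod_alternating_Cons by simp
qed simp

lemma prod_list_alternating:
  "prod_list xs = (\<Prod>i<(length xs + 1) div 2. xs ! (2 * i)) *
     (\<Prod>i<length xs div 2. xs ! (2 * i + 1))" for xs :: "nat list"
proof (induction xs)
  case (Cons x xs)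
  thus ?case
    unfolding prod_alternating_Cons by simp
qed simp

section \<open>Recovering the sequence from its tiles\<close>

lemma zero_in_tiles: "\<forall>x\<in>set xs. x > 1 \<Longrightarrow> 0 \<in> left_tile xs \<and> 0 \<in> right_tile xs"
  by (induction xs) (auto simp: centered_def intro!: image_eqI[of _ _ "(0, 0)"])

lemma centered_subset_left_tile:
  assumes "\<forall>y\<in>set (x # xs). y > 1"
  shows "centered x \<subseteq> left_tile (x # xs)"
proof
  fix s
  assume "s \<in> centered x"
  thus "s \<in> left_tile (x # xs)"
    using zero_in_tiles[of xs] assms by (auto intro!: image_eqI[of _ _ "(s, 0)"])
qed

lemma one_in_left_tile:
  assumes "\<forall>y\<in>set xs. y > 1 \<and> odd y" "xs \<noteq> []"
  shows "1 \<in> left_tile xs"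
proof (cases xs)
  case (Cons x ys)
  have "x > 2"
    using assms Cons by (cases "x = 2") auto
  hence "1 \<in> centered x"
    by (simp add: centered_def)
  thus ?thesis
    using centered_subset_left_tile[of x ys] assms Cons by auto
qed (use assms in simp)

text \<open>A right tile consists of multiples of the first factor, or is
  \<open>{0}\<close>.\<close>

lemma one_notin_right_tile: "\<forall>x\<in>set xs. x > 1 \<Longrightarrow> 1 \<notin> right_tile xs"
  by (cases xs) (auto simp: zmult_eq_1_iff dest!: sym[of 1])

text \<open>If x = 2h + 1 were smaller than y, then y would be at least x + 2 and h + 1 a centered
  digit for y. In radix x, however, h + 1 = -h + x, so the right tile of the tail would contain
  1.\<close>

lemma first_factor_le:
  assumes "\<forall>z\<in>set (x # xs). z > 1 \<and> odd z" "\<forall>z\<in>set (y # ys). z > 1 \<and> odd z"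
    and "left_tile (x # xs) = left_tile (y # ys)"
  shows "y \<le> x"
proof (rule ccontr)
  assume "\<not> y \<le> x"
  have "odd x"
    using assms(1) by simp
  then obtain h where h: "x = 2 * h + 1"
    by (rule oddE)
  have "y \<noteq> x + 1"
    using assms(1,2) by auto
  hence "int h + 1 \<in> centered y"
    using \<open>\<not> y \<le> x\<close> h by (simp add: centered_def)
  hence "int h + 1 \<in> left_tile (x # xs)"
    using centered_subset_left_tile[of y ys] assms(2,3) by auto
  then obtain s b where sb: "int h + 1 = s + int x * b" "s \<in> centered x" "b \<in> right_tile xs"
    by auto
  hence "s + int x * b = - int h + int x * 1"
    using h by simp
  moreover have "- int h \<in> centered x"
    using h by (simp add: centered_def)
  ultimately have "b = 1"
    using centered_digit_unique(2)[OF sb(2)] by blast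
  with sb(3) one_notin_right_tile[of xs] assms(1) show False
    by auto
qed

text \<open>Multiples of \<open>x\<close> in the left tile are exactly the elements with lowest
  digit 0. Thus \<open>x\<close> and the two tiles determine the tiles of the tail.\<close>

lemma tiles_Cons_vimage:
  assumes "x > 0"
  shows "left_tile xs = {a. int x * a \<in> right_tile (x # xs)}"
    "right_tile xs = {b. int x * b \<in> left_tile (x # xs)}"
proof -
  show "left_tile xs = {a. int x * a \<in> right_tile (x # xs)}"
    using assms by auto
  have "0 \<in> centered x"
    using assms by (simp add: centered_def)
  hence "int x * b = s + int x * b' \<Longrightarrow> s \<in> centered x \<Longrightarrow> b = b'" for s b b'
    using centered_digit_unique(2)[of 0 x s b b'] by simp
  thus "right_tile xs = {b. int x * b \<in> left_tile (x # xs)}"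
    using \<open>0 \<in> centered x\<close> by (auto intro: image_eqI[of _ _ "(0, _)"])
qed

text \<open>\<open>first_factor_le\<close> in both directions identifies the heads, and division by
  the head reduces to the tails. The empty list is recognized by 1 missing from its left
  tile.\<close>

lemma tiles_inject:
  assumes "\<forall>z\<in>set xs. z > 1 \<and> odd z" "\<forall>z\<in>set ys. z > 1 \<and> odd z"
    and "left_tile xs = left_tile ys" "right_tile xs = right_tile ys"
  shows "xs = ys"
  using assms
proof (induction xs arbitrary: ys)
  case Nil
  hence "left_tile ys = {0}"
    by simp
  thus ?case
    using one_in_left_tile[of ys] Nil.prems(2) by auto
next
  case (Cons x xs)
  show ?case
  proof (cases ys)
    case Nil
    thus ?thesis
      using Cons.prems one_in_left_tile[of "x # xs"] by simp
  next
    case ys: (Cons y zs)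
    have "x = y"
      using first_factor_le[of x xs y zs] first_factor_le[of y zs x xs] Cons.prems ys
      by (simp del: left_tile.simps right_tile.simps)
    moreover have "left_tile xs = left_tile zs" "right_tile xs = right_tile zs"
      using tiles_Cons_vimage[of x xs] tiles_Cons_vimage[of y zs] Cons.prems ys \<open>x = y\<close>
      by (simp_all del: left_tile.simps right_tile.simps)
    ultimately show ?thesis
      using Cons.IH[of zs] Cons.prems ys by simp
  qed
qed

section \<open>Ordered pairs of symmetric tiles of an interval\<close>

definition symmetric_tilings :: "nat \<Rightarrow> (int set \<times> int set) set" where
  "symmetric_tilings m = {(A, B). symmetric_set A \<and> symmetric_set B \<and> card A = m \<and> card B = m \<and>
     bij_betw (\<lambda>(a, b). a + b) (A \<times> B) (centered (m * m))}"

text \<open>Both tiles contain 0, hence each of them lies inside the tiled interval.\<close>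

lemma finite_symmetric_tilings:
  assumes "odd m"
  shows "finite (symmetric_tilings m)"
proof (rule finite_subset)
  let ?C = "centered (m * m)"
  show "symmetric_tilings m \<subseteq> Pow ?C \<times> Pow ?C"
  proof clarify
    fix A B
    assume "(A, B) \<in> symmetric_tilings m"
    hence AB: "symmetric_set A" "symmetric_set B" "card A = m" "card B = m"
        and b: "\<And>a b. a \<in> A \<Longrightarrow> b \<in> B \<Longrightarrow> a + b \<in> ?C"
      by (auto simp: symmetric_tilings_def dest!: bij_betw_apply)
    have "m > 0"
      using assms by (auto intro: Nat.gr0I)
    hence "finite A" "finite B"
      using AB by (auto intro: card_ge_0_finite)
    hence "0 \<in> A" "0 \<in> B"
      using odd_symmetric_set(1) AB assms by auto
    thus "A \<in> Pow ?C \<and> B \<in> Pow ?C"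
      using b[of _ 0] b[of 0] by auto
  qed
qed (simp add: finite_centered)

lemma proj_factorization_seqs_tiles:
  assumes "xs \<in> proj_factorization_seqs m m" "odd m"
  shows "\<forall>x\<in>set xs. x > 1 \<and> odd x" "xs \<noteq> []"
    "(left_tile xs, right_tile xs) \<in> symmetric_tilings m"
proof -
  have gt: "\<forall>x\<in>set xs. x > 1" and ne: "xs \<noteq> []"
    using assms(1) by (auto simp: proj_factorization_seqs_def)
  \<comment> \<open>The rounding in the bounds covers sequences of even and of odd length at
    once.\<close>
  have m: "(\<Prod>i<(length xs + 1) div 2. xs ! (2 * i)) = m" "(\<Prod>i<length xs div 2. xs ! (2 * i + 1)) = m"
    using assms(1) by (auto simp: proj_factorization_seqs_def)
  have prod: "prod_list xs = m * m"
    using m by (simp add: prod_list_alternating)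
  have odd: "\<forall>x\<in>set xs. odd x"
  proof
    fix x
    assume "x \<in> set xs"
    then obtain us vs where "xs = us @ x # vs"
      by (auto dest: split_list)
    hence "x dvd prod_list xs"
      by simp
    \<comment> \<open>Every entry divides an odd number and is therefore odd, as centered digits
      require.\<close>
    hence "x dvd m * m"
      by (simp only: prod)
    thus "odd x"
      using assms(2) by (meson dvd_trans even_mult_iff)
  qed
  show "\<forall>x\<in>set xs. x > 1 \<and> odd x" "xs \<noteq> []"
    using gt odd ne by auto
  show "(left_tile xs, right_tile xs) \<in> symmetric_tilings m"
    using symmetric_tiles[of xs] card_tiles[OF odd] bij_betw_tiles[OF odd] m prod
    by (simp add: symmetric_tilings_def)
qed

lemma symmetric_tilings_swap:
  assumes "(A, B) \<in> symmetric_tilings m"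
  shows "(B, A) \<in> symmetric_tilings m"
proof -
  have "bij_betw ((\<lambda>(a, b). a + b) \<circ> prod.swap) (B \<times> A) (centered (m * m))"
    using assms by (intro bij_betw_trans[of prod.swap _ "A \<times> B"])
      (auto simp: symmetric_tilings_def bij_betw_def)
  moreover have "(\<lambda>(a, b). a + b) \<circ> prod.swap = (\<lambda>(a :: int, b). a + b)"
    by (auto simp: fun_eq_iff)
  ultimately show ?thesis
    using assms by (simp add: symmetric_tilings_def)
qed

text \<open>The factor 2: the tile containing 1 may play either role.\<close>

lemma card_symmetric_tilings_ge:
  assumes "odd m"
  shows "2 * tau m m \<le> card (symmetric_tilings m)"
proof -
  let ?S = "proj_factorization_seqs m m"
  define T where "T = (\<lambda>xs. (left_tile xs, right_tile xs)) ` ?S"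
  note S = proj_factorization_seqs_tiles[OF _ assms]
  have "inj_on (\<lambda>xs. (left_tile xs, right_tile xs)) ?S"
    by (rule inj_onI) (use S(1) tiles_inject in auto)
  hence cT: "card T = tau m m"
    by (simp add: T_def tau_def card_image)
  have sub: "T \<subseteq> symmetric_tilings m" "prod.swap ` T \<subseteq> symmetric_tilings m"
    using S(3) by (auto simp: T_def intro: symmetric_tilings_swap)
  have "1 \<in> fst t \<and> 1 \<notin> snd t" if "t \<in> T" for t
    using that S(1,2) by (auto simp: T_def one_in_left_tile one_notin_right_tile)
  hence "t \<notin> prod.swap ` T" if "t \<in> T" for t
    using that by (metis image_iff fst_swap)
  hence "T \<inter> prod.swap ` T = {}"
    by blast
  moreover have "card (prod.swap ` T) = card T"
    by (simp add: card_image)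
  ultimately have "2 * tau m m = card (T \<union> prod.swap ` T)"
    using sub finite_symmetric_tilings[OF assms] cT
    by (subst card_Un_disjoint) (auto intro: finite_subset)
  also have "\<dots> \<le> card (symmetric_tilings m)"
    using sub finite_symmetric_tilings[OF assms] by (intro card_mono) auto
  finally show ?thesis .
qed

text \<open>\<open>parity_sign\<close> is multiplicative, so its sum over the interval is the
  product of the sums over the tiles. Integers whose product is 1 or -1 are themselves 1 or
  -1.\<close>

lemma symmetric_tiling_parity:
  assumes "(A, B) \<in> symmetric_tilings m" "odd m"
  shows "\<bar>sum parity_sign A\<bar> = 1" "\<bar>sum parity_sign B\<bar> = 1"
proof -
  have "bij_betw (\<lambda>(a, b). a + b) (A \<times> B) (centered (m * m))"
    using assms(1) by (simp add: symmetric_tilings_def)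
  hence "sum parity_sign (centered (m * m)) = (\<Sum>(a, b)\<in>A \<times> B. parity_sign (a + b))"
    by (simp add: sum.reindex_bij_betw[symmetric] case_prod_unfold)
  also have "\<dots> = sum parity_sign A * sum parity_sign B"
    by (simp add: parity_sign_add sum_product sum.cartesian_product)
  finally have "\<bar>sum parity_sign A * sum parity_sign B\<bar> = 1"
    using sum_parity_sign_centered[of "m * m"] assms(2) by simp
  thus "\<bar>sum parity_sign A\<bar> = 1" "\<bar>sum parity_sign B\<bar> = 1"
    by (metis abs_zmult_eq_1 mult.commute)+
qed

section \<open>Labelings from tilings\<close>

text \<open>The coordinate in which, for odd \<open>m\<close>, reversing a row or column index
  becomes negation.\<close>

definition offset :: "nat \<Rightarrow> nat \<Rightarrow> int" where
  "offset m i = int i - int ((m + 1) div 2)"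

lemma offset_Suc: "offset m (i + 1) = offset m i + 1"
  by (simp add: offset_def)

lemma offset_reflect:
  assumes "odd m" "i \<le> m"
  shows "offset m (m + 1 - i) = - offset m i"
  using assms by (elim oddE) (simp add: offset_def)

lemma offset_in_centered:
  assumes "odd m" "i \<in> {1..m}"
  shows "offset m i \<in> centered m"
proof -
  obtain k where m: "m = 2 * k + 1"
    using assms(1) by (rule oddE)
  hence "1 \<le> int i" "int i \<le> 2 * int k + 1"
    using assms(2) by auto
  hence "\<bar>int i - (int k + 1)\<bar> \<le> int k"
    by (simp add: abs_le_iff)
  thus ?thesis
    by (simp add: m offset_def centered_def add.commute)
qed

lemma offset_surj:
  assumes "odd m" "d \<in> centered m"
  obtains i where "i \<in> {1..m}" "offset m i = d"
proof -
  obtain k where m: "m = 2 * k + 1"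
    using assms(1) by (rule oddE)
  hence d: "- int k \<le> d" "d \<le> int k"
    using assms(2) by (simp_all add: centered_def)
  show ?thesis
  proof
    show "nat (d + int k + 1) \<in> {1..m}"
      using d by (simp add: m nat_le_iff)
    show "offset m (nat (d + int k + 1)) = d"
      using d by (simp add: m offset_def)
  qed
qed

text \<open>Twice the label at the vertex with centered coordinates \<open>(d, e)\<close>; the sign
  of the variable part alternates as on a chessboard.\<close>

definition twice_label ::
    "int \<times> int \<times> int \<Rightarrow> (int \<Rightarrow> int) \<Rightarrow> (int \<Rightarrow> int) \<Rightarrow> int \<Rightarrow> int \<Rightarrow> int" where
  "twice_label = (\<lambda>(p, q, w) \<alpha> \<beta> d e.
     if even (d + e) then p + w * (\<alpha> d + \<beta> e) else q - w * (\<alpha> d + \<beta> e))"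

definition tile_labeling ::
    "nat \<Rightarrow> int \<times> int \<times> int \<Rightarrow> (int \<Rightarrow> int) \<Rightarrow> (int \<Rightarrow> int) \<Rightarrow> nat \<times> nat \<Rightarrow> nat" where
  "tile_labeling m c \<alpha> \<beta> =
     (\<lambda>(i, j)\<in>proj_vertices m m. nat (twice_label c \<alpha> \<beta> (offset m i) (offset m j) div 2))"

text \<open>Evenness makes the division in \<open>tile_labeling\<close> exact, the lower bound does
  the same for \<open>nat\<close>, and injectivity together with the range gives a bijection by
  counting.\<close>

definition valid_twice_label ::
    "nat \<Rightarrow> int \<times> int \<times> int \<Rightarrow> (int \<Rightarrow> int) \<Rightarrow> (int \<Rightarrow> int) \<Rightarrow> bool" where
  "valid_twice_label m c \<alpha> \<beta> \<longleftrightarrow>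
     inj_on (\<lambda>(d, e). twice_label c \<alpha> \<beta> d e) (centered m \<times> centered m) \<and>
     (\<forall>d\<in>centered m. \<forall>e\<in>centered m. even (twice_label c \<alpha> \<beta> d e) \<and>
        2 \<le> twice_label c \<alpha> \<beta> d e \<and> twice_label c \<alpha> \<beta> d e \<le> 2 * int (m * m))"

lemma twice_tile_labeling:
  assumes "odd m" "valid_twice_label m c \<alpha> \<beta>" "i \<in> {1..m}" "j \<in> {1..m}"
  shows "2 * int (tile_labeling m c \<alpha> \<beta> (i, j)) = twice_label c \<alpha> \<beta> (offset m i) (offset m j)"
proof -
  let ?t = "twice_label c \<alpha> \<beta> (offset m i) (offset m j)"
  have "even ?t" "2 \<le> ?t"
    using assms offset_in_centered unfolding valid_twice_label_def by auto
  thus ?thesis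
    using assms(3,4) by (simp add: tile_labeling_def proj_vertices_def)
qed

lemma bij_betw_tile_labeling:
  assumes "odd m" "valid_twice_label m c \<alpha> \<beta>"
  shows "bij_betw (tile_labeling m c \<alpha> \<beta>) (proj_vertices m m) {1..m * m}"
proof -
  let ?f = "tile_labeling m c \<alpha> \<beta>" and ?V = "proj_vertices m m"
  note twice = twice_tile_labeling[OF assms]
  have "inj_on ?f ?V"
  proof (rule inj_onI, clarify)
    fix i j i' j'
    assume V: "(i, j) \<in> ?V" "(i', j') \<in> ?V" and eq: "?f (i, j) = ?f (i', j')"
    hence r: "i \<in> {1..m}" "j \<in> {1..m}" "i' \<in> {1..m}" "j' \<in> {1..m}"
      by (auto simp: proj_vertices_def)
    have "twice_label c \<alpha> \<beta> (offset m i) (offset m j) = twice_label c \<alpha> \<beta> (offset m i') (offset m j')"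
      using twice[OF r(1,2)] twice[OF r(3,4)] eq by simp
    hence "(offset m i, offset m j) = (offset m i', offset m j')"
      using assms r offset_in_centered unfolding valid_twice_label_def
      by (auto dest: inj_onD[where x = "(offset m i, offset m j)" and y = "(offset m i', offset m j')"])
    thus "i = i' \<and> j = j'"
      by (simp add: offset_def)
  qed
  moreover have "?f ` ?V \<subseteq> {1..m * m}"
  proof clarify
    fix i j
    assume "(i, j) \<in> ?V"
    hence r: "i \<in> {1..m}" "j \<in> {1..m}"
      by (auto simp: proj_vertices_def)
    hence "2 \<le> twice_label c \<alpha> \<beta> (offset m i) (offset m j)"
        "twice_label c \<alpha> \<beta> (offset m i) (offset m j) \<le> 2 * int (m * m)"
      using assms offset_in_centered unfolding valid_twice_label_def by auto
    hence "1 \<le> int (?f (i, j))" "int (?f (i, j)) \<le> int (m * m)"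
      using twice[OF r] by linarith+
    thus "?f (i, j) \<in> {1..m * m}"
      by (simp only: of_nat_le_iff atLeastAtMost_iff) simp
  qed
  moreover have "card ?V = m * m"
    by (simp add: proj_vertices_def)
  ultimately show ?thesis
    unfolding bij_betw_def by (simp add: card_subset_eq card_image)
qed

lemma tile_labeling_magic:
  assumes "odd m" "valid_twice_label m (p, q, w) \<alpha> \<beta>"
    and "\<forall>d\<in>centered m. \<alpha> (- d) = - \<alpha> d" "\<forall>d\<in>centered m. \<beta> (- d) = - \<beta> d"
    and "F \<in> proj_C4_faces m m"
  shows "(\<Sum>v\<in>F. tile_labeling m (p, q, w) \<alpha> \<beta> v) = nat (p + q)"
proof -
  let ?f = "tile_labeling m (p, q, w) \<alpha> \<beta>" and ?t = "twice_label (p, q, w) \<alpha> \<beta>"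
  note twice = twice_tile_labeling[OF assms(1,2)]
  \<comment> \<open>Since \<open>p\<close> and \<open>q\<close> are doubled constants, the doubled
    face sum is \<open>2 * (p + q)\<close>.\<close>
  have suff: "(\<Sum>v\<in>F. ?f v) = nat (p + q)"
    if "2 * int (\<Sum>v\<in>F. ?f v) = 2 * (p + q)"
    using that by (metis mult_cancel_left nat_int zero_neq_numeral)
  have four: "sum ?f {v1, v2, v3, v4} = ?f v1 + ?f v2 + ?f v3 + ?f v4"
    if "distinct [v1, v2, v3, v4]" for v1 v2 v3 v4
    using that by simp
  have tneg: "?t (- d) (- e) + ?t d e = (if even (d + e) then 2 * p else 2 * q)"
    if "d \<in> centered m" "e \<in> centered m" for d e
  proof -
    have "\<alpha> (- d) = - \<alpha> d" "\<beta> (- e) = - \<beta> e"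
      using that assms(3,4) by auto
    moreover have "even (- d + - e) \<longleftrightarrow> even (d + e)"
      by presburger
    ultimately show ?thesis
      by (auto simp: twice_label_def algebra_simps)
  qed
  \<comment> \<open>A wrap-around face consists of an edge and its antipodal edge. Its two antipodal
    pairs have different parities, so one contributes \<open>2 * p\<close> and the other
    \<open>2 * q\<close>.\<close>
  have wrap: "?t d e + ?t d' e' + ?t (- d) (- e) + ?t (- d') (- e') = 2 * (p + q)"
    if "d \<in> centered m" "e \<in> centered m" "d' \<in> centered m" "e' \<in> centered m"
      "even (d + e) \<noteq> even (d' + e')" for d e d' e'
    using tneg[OF that(1,2)] tneg[OF that(3,4)] that(5) by (auto split: if_splits)
  have refl: "offset m (m + 1 - i) = - offset m i" if "i \<le> m" for i
    by (rule offset_reflect[OF assms(1) that])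
  \<comment> \<open>The index \<open>m - i\<close> is the reflection of \<open>i + 1\<close>, which
    is why the bound is \<open>m - 1\<close> here.\<close>
  have refl': "offset m (m - i) = - (offset m i + 1)" if "i \<le> m - 1" "1 \<le> i" for i
    using offset_reflect[OF assms(1), of "i + 1"] that by (simp add: offset_def)
  have one: "offset m 1 = - offset m m"
    using refl[of m] by simp
  note mem = offset_in_centered[OF assms(1)]
  from assms(5) consider
      (inner) i j where "F = {(i, j), (i + 1, j), (i, j + 1), (i + 1, j + 1)}"
        "1 \<le> i" "i \<le> m - 1" "1 \<le> j" "j \<le> m - 1"
    | (right) i where "F = {(i, m), (i + 1, m), (m + 1 - i, 1), (m - i, 1)}" "1 \<le> i" "i \<le> m - 1"
    | (bottom) j where "F = {(m, j), (m, j + 1), (1, m + 1 - j), (1, m - j)}" "1 \<le> j" "j \<le> m - 1"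
    unfolding proj_C4_faces_def by blast
  thus ?thesis
  proof cases
    case inner
    have r: "i \<in> {1..m}" "i + 1 \<in> {1..m}" "j \<in> {1..m}" "j + 1 \<in> {1..m}"
      using inner by auto
    have "2 * int (\<Sum>v\<in>F. ?f v) = 2 * int (?f (i, j)) + 2 * int (?f (i + 1, j))
        + 2 * int (?f (i, j + 1)) + 2 * int (?f (i + 1, j + 1))"
      unfolding inner(1) by (subst four) auto
    also have "\<dots> = ?t (offset m i) (offset m j) + ?t (offset m i + 1) (offset m j)
        + ?t (offset m i) (offset m j + 1) + ?t (offset m i + 1) (offset m j + 1)"
      unfolding twice[OF r(1,3)] twice[OF r(2,3)] twice[OF r(1,4)] twice[OF r(2,4)] offset_Suc ..
    \<comment> \<open>Diagonally opposite vertices share a parity. Both diagonals have the same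
      variable part, and it enters with opposite signs.\<close>
    also have "\<dots> = 2 * (p + q)"
      by (simp add: twice_label_def algebra_simps)
    finally show ?thesis
      by (rule suff)
  next
    case right
    have r: "i \<in> {1..m}" "i + 1 \<in> {1..m}" "m + 1 - i \<in> {1..m}" "m - i \<in> {1..m}"
        "m \<in> {1..m}" "1 \<in> {1..m}"
      using right by auto
    have "2 * int (\<Sum>v\<in>F. ?f v) = 2 * int (?f (i, m)) + 2 * int (?f (i + 1, m))
        + 2 * int (?f (m + 1 - i, 1)) + 2 * int (?f (m - i, 1))"
      unfolding right(1) by (subst four) (use right in auto)
    also have "\<dots> = ?t (offset m i) (offset m m) + ?t (offset m i + 1) (offset m m)
        + ?t (- offset m i) (- offset m m) + ?t (- (offset m i + 1)) (- offset m m)"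
      unfolding twice[OF r(1,5)] twice[OF r(2,5)] twice[OF r(3,6)] twice[OF r(4,6)]
      using right by (simp only: offset_Suc refl refl' one r)
    also have "\<dots> = 2 * (p + q)"
      using mem[OF r(1)] mem[OF r(2), unfolded offset_Suc] mem[OF r(5)] by (intro wrap) auto
    finally show ?thesis
      by (rule suff)
  next
    case bottom
    have r: "j \<in> {1..m}" "j + 1 \<in> {1..m}" "m + 1 - j \<in> {1..m}" "m - j \<in> {1..m}"
        "m \<in> {1..m}" "1 \<in> {1..m}"
      using bottom by auto
    have "2 * int (\<Sum>v\<in>F. ?f v) = 2 * int (?f (m, j)) + 2 * int (?f (m, j + 1))
        + 2 * int (?f (1, m + 1 - j)) + 2 * int (?f (1, m - j))"
      unfolding bottom(1) by (subst four) (use bottom in auto)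
    also have "\<dots> = ?t (offset m m) (offset m j) + ?t (offset m m) (offset m j + 1)
        + ?t (- offset m m) (- offset m j) + ?t (- offset m m) (- (offset m j + 1))"
      unfolding twice[OF r(5,1)] twice[OF r(5,2)] twice[OF r(6,3)] twice[OF r(6,4)]
      using bottom by (simp only: offset_Suc refl refl' one r)
    also have "\<dots> = 2 * (p + q)"
      using mem[OF r(1)] mem[OF r(2), unfolded offset_Suc] mem[OF r(5)] by (intro wrap) auto
    finally show ?thesis
      by (rule suff)
  qed
qed

section \<open>Plain and split offsets\<close>

definition half_range :: "nat \<Rightarrow> int" where
  "half_range m = (int (m * m) - 1) div 2"

lemma half_range:
  assumes "odd m"
  shows "2 * half_range m + 1 = int (m * m)" "even (half_range m)"
proof -
  obtain k where "m = 2 * k + 1"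
    using assms by (rule oddE)
  hence m: "int (m * m) = 2 * (2 * (int k * (int k + 1))) + 1"
    by (simp add: algebra_simps)
  show "2 * half_range m + 1 = int (m * m)" "even (half_range m)"
    unfolding half_range_def m by simp_all
qed

lemma half_range_pos:
  assumes "odd m" "m > 1"
  shows "half_range m > 0"
proof -
  have "1 * 1 < m * m"
    using assms(2) by (intro mult_strict_mono) auto
  thus ?thesis
    using half_range(1)[OF assms(1)] by linarith
qed

text \<open>Doubled values of \<open>(p, q, w)\<close>, so that the half-integral weight \<open>w = 1/2\<close> stays in the
  integers.\<close>

definition plain_offset :: "nat \<Rightarrow> int \<times> int \<times> int" where
  "plain_offset m = (2 * half_range m + 2, 2 * half_range m + 2, 2)"

text \<open>Write N for \<open>half_range m\<close>, which is even for odd \<open>m\<close>. The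
  first triple sends even sums to the doubled labels 2, ..., 2N + 2 and odd sums to 2N + 4, ..., 4N
  + 2; the second sends odd sums to 2, ..., 2N and even sums to 2N + 2, ..., 4N + 2.\<close>

definition split_offsets :: "nat \<Rightarrow> (int \<times> int \<times> int) set" where
  "split_offsets m = {(half_range m + 2, 3 * half_range m + 3, 1),
     (3 * half_range m + 2, half_range m + 1, 1)}"

lemma symmetric_tilings_sum:
  assumes "odd m" "(A, B) \<in> symmetric_tilings m" "\<alpha> \<in> odd_bijections (centered m) A"
    "\<beta> \<in> odd_bijections (centered m) B"
  shows "inj_on (\<lambda>(d, e). \<alpha> d + \<beta> e) (centered m \<times> centered m)"
    "\<And>d e. d \<in> centered m \<Longrightarrow> e \<in> centered m \<Longrightarrow> \<bar>\<alpha> d + \<beta> e\<bar> \<le> half_range m"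
proof -
  let ?D = "centered m"
  have \<alpha>: "bij_betw \<alpha> ?D A" and \<beta>: "bij_betw \<beta> ?D B"
    using assms(3,4) by (auto simp: odd_bijections_def bijections_def)
  have s: "bij_betw (\<lambda>(a, b). a + b) (A \<times> B) (centered (m * m))"
    using assms(2) by (simp add: symmetric_tilings_def)
  show "inj_on (\<lambda>(d, e). \<alpha> d + \<beta> e) (?D \<times> ?D)"
  proof (rule inj_onI, clarify)
    fix d e d' e'
    assume r: "d \<in> ?D" "e \<in> ?D" "d' \<in> ?D" "e' \<in> ?D" and eq: "\<alpha> d + \<beta> e = \<alpha> d' + \<beta> e'"
    have "(\<alpha> d, \<beta> e) \<in> A \<times> B" "(\<alpha> d', \<beta> e') \<in> A \<times> B"
      using r bij_betw_apply[OF \<alpha>] bij_betw_apply[OF \<beta>] by auto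
    hence "(\<alpha> d, \<beta> e) = (\<alpha> d', \<beta> e')"
      by (rule inj_onD[OF bij_betw_imp_inj_on[OF s], rotated]) (simp add: eq)
    thus "d = d' \<and> e = e'"
      using r bij_betw_imp_inj_on[OF \<alpha>] bij_betw_imp_inj_on[OF \<beta>] by (auto dest: inj_onD)
  qed
  fix d e
  assume "d \<in> ?D" "e \<in> ?D"
  hence "(\<alpha> d, \<beta> e) \<in> A \<times> B"
    using bij_betw_apply[OF \<alpha>] bij_betw_apply[OF \<beta>] by auto
  hence "\<alpha> d + \<beta> e \<in> centered (m * m)"
    using bij_betw_apply[OF s] by force
  thus "\<bar>\<alpha> d + \<beta> e\<bar> \<le> half_range m"
    using half_range(1)[OF assms(1)] by (simp add: centered_def)
qed

lemma valid_plain: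
  assumes "odd m" "(A, B) \<in> symmetric_tilings m" "\<alpha> \<in> odd_bijections (centered m) A"
    "\<beta> \<in> odd_bijections (centered m) B"
  shows "valid_twice_label m (plain_offset m) \<alpha> \<beta>"
proof -
  let ?D = "centered m" and ?t = "twice_label (plain_offset m) \<alpha> \<beta>"
  note inj = symmetric_tilings_sum(1)[OF assms] and bound = symmetric_tilings_sum(2)[OF assms]
  have odd: "\<alpha> (- d) = - \<alpha> d" "\<beta> (- d) = - \<beta> d" "- d \<in> ?D" if "d \<in> ?D" for d
    using assms(3,4) that by (auto simp: odd_bijections_def centered_def)
  have t: "?t d e = 2 * (half_range m + 1 + (if even (d + e) then \<alpha> d + \<beta> e else - (\<alpha> d + \<beta> e)))"
    for d e
    by (simp add: twice_label_def plain_offset_def)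
  have "inj_on (\<lambda>(d, e). ?t d e) (?D \<times> ?D)"
  proof (rule inj_onI, clarify)
    fix d e d' e'
    assume r: "d \<in> ?D" "e \<in> ?D" "d' \<in> ?D" "e' \<in> ?D" and eq: "?t d e = ?t d' e'"
    have *: "x = d \<and> y = e" if "\<alpha> x + \<beta> y = \<alpha> d + \<beta> e" "x \<in> ?D" "y \<in> ?D" for x y
      using inj_onD[OF inj, of "(x, y)" "(d, e)"] that r by simp
    show "d = d' \<and> e = e'"
    proof (cases "even (d + e) \<longleftrightarrow> even (d' + e')")
      case True
      thus ?thesis
        using eq *[of d' e'] r by (auto simp: t split: if_splits)
    next
      case False
      \<comment> \<open>A collision between different parities means opposite sums. By oddness and
        injectivity the two vertices are then antipodal, but antipodal vertices have the same
        parity.\<close>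
      hence "\<alpha> (- d') + \<beta> (- e') = \<alpha> d + \<beta> e"
        using eq odd r by (auto simp: t split: if_splits)
      hence "- d' = d \<and> - e' = e"
        using r odd(3) by (intro *)
      with False show ?thesis
        by auto
    qed
  qed
  moreover have "even (?t d e)" "2 \<le> ?t d e" "?t d e \<le> 2 * int (m * m)"
    if "d \<in> ?D" "e \<in> ?D" for d e
  proof -
    define v where "v = (if even (d + e) then \<alpha> d + \<beta> e else - (\<alpha> d + \<beta> e))"
    have v: "?t d e = 2 * (half_range m + 1 + v)" "\<bar>v\<bar> \<le> half_range m"
      using bound[OF that] t[of d e] by (simp_all only: v_def abs_minus_cancel split: if_split) simp
    show "even (?t d e)" "2 \<le> ?t d e" "?t d e \<le> 2 * int (m * m)"
      using v half_range(1)[OF assms(1)] by simp_all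
  qed
  ultimately show ?thesis
    unfolding valid_twice_label_def by blast
qed

lemma valid_split:
  assumes "odd m" "(A, B) \<in> symmetric_tilings m" "\<alpha> \<in> odd_bijections (centered m) A"
    "\<beta> \<in> odd_bijections (centered m) B"
    and "\<alpha> \<in> parity_preserving (centered m)" "\<beta> \<in> parity_preserving (centered m)"
    and "c \<in> split_offsets m"
  shows "valid_twice_label m c \<alpha> \<beta>"
proof -
  let ?D = "centered m" and ?t = "twice_label c \<alpha> \<beta>" and ?N = "half_range m"
  note inj = symmetric_tilings_sum(1)[OF assms(1-4)]
  note bound = symmetric_tilings_sum(2)[OF assms(1-4)]
  note N = half_range[OF assms(1)]
  have par: "even (\<alpha> d + \<beta> e) \<longleftrightarrow> even (d + e)" if "d \<in> ?D" "e \<in> ?D" for d e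
    using assms(5,6) that by (auto simp: parity_preserving_def)
  obtain p q where c: "c = (p, q, 1)" and
    pq: "p = ?N + 2 \<and> q = 3 * ?N + 3 \<or> p = 3 * ?N + 2 \<and> q = ?N + 1"
    using assms(7) by (auto simp: split_offsets_def)
  have t: "?t d e = (if even (d + e) then p + (\<alpha> d + \<beta> e) else q - (\<alpha> d + \<beta> e))" for d e
    by (simp add: twice_label_def c)
  \<comment> \<open>An odd sum cannot equal the even number N in absolute value. The gain of 1 keeps
    the odd class inside the label range.\<close>
  have odd_bound: "\<bar>\<alpha> d + \<beta> e\<bar> \<le> ?N - 1" if "d \<in> ?D" "e \<in> ?D" "odd (d + e)" for d e
  proof -
    have "\<bar>\<alpha> d + \<beta> e\<bar> \<noteq> ?N"
      using par[OF that(1,2)] that(3) N(2) by (metis dvd_abs_iff)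
    thus ?thesis
      using bound[OF that(1,2)] by simp
  qed
  have "inj_on (\<lambda>(d, e). ?t d e) (?D \<times> ?D)"
  proof (rule inj_onI, clarify)
    fix d e d' e'
    assume r: "d \<in> ?D" "e \<in> ?D" "d' \<in> ?D" "e' \<in> ?D" and eq: "?t d e = ?t d' e'"
    have "even (d + e) \<longleftrightarrow> even (d' + e')"
    proof (rule ccontr)
      assume "even (d + e) \<noteq> even (d' + e')"
      then consider "even (d + e)" "odd (d' + e')" | "odd (d + e)" "even (d' + e')"
        by blast
      thus False
      proof cases
        case 1
        thus False
          using eq bound[OF r(1,2)] odd_bound[OF r(3,4)] pq unfolding t by auto
      next
        case 2
        thus False
          using eq bound[OF r(3,4)] odd_bound[OF r(1,2)] pq unfolding t by auto
      qed
    qed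
    hence "\<alpha> d + \<beta> e = \<alpha> d' + \<beta> e'"
      using eq by (auto simp: t split: if_splits)
    thus "d = d' \<and> e = e'"
      using inj_onD[OF inj, of "(d, e)" "(d', e')"] r by simp
  qed
  moreover have "even (?t d e) \<and> 2 \<le> ?t d e \<and> ?t d e \<le> 2 * int (m * m)"
    if "d \<in> ?D" "e \<in> ?D" for d e
  proof (cases "even (d + e)")
    case True
    hence te: "?t d e = p + (\<alpha> d + \<beta> e)" and ev: "even (\<alpha> d + \<beta> e)"
      using par[OF that] by (simp_all add: t)
    have "even p"
      using pq N(2) by auto
    hence "even (?t d e)"
      unfolding te using ev by (rule dvd_add)
    thus ?thesis
      using bound[OF that] pq N(1) unfolding te by auto
  next
    case False
    hence te: "?t d e = q - (\<alpha> d + \<beta> e)" and ev: "odd (\<alpha> d + \<beta> e)"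
      using par[OF that] by (simp_all add: t)
    have "odd q"
      using pq N(2) by auto
    hence "even (?t d e)"
      unfolding te using ev by presburger
    thus ?thesis
      using odd_bound[OF that False] pq N(1) unfolding te by auto
  qed
  ultimately show ?thesis
    unfolding valid_twice_label_def by blast
qed

section \<open>Counting the constructed labelings\<close>

definition plain_pairs :: "nat \<Rightarrow> ((int \<Rightarrow> int) \<times> (int \<Rightarrow> int)) set" where
  "plain_pairs m = (\<Union>(A, B)\<in>symmetric_tilings m.
     odd_bijections (centered m) A \<times> odd_bijections (centered m) B)"

definition split_pairs :: "nat \<Rightarrow> ((int \<Rightarrow> int) \<times> (int \<Rightarrow> int)) set" where
  "split_pairs m = (\<Union>(A, B)\<in>symmetric_tilings m.
     (odd_bijections (centered m) A \<inter> parity_preserving (centered m)) \<times>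
     (odd_bijections (centered m) B \<inter> parity_preserving (centered m)))"

definition magic_data :: "nat \<Rightarrow> ((int \<times> int \<times> int) \<times> (int \<Rightarrow> int) \<times> (int \<Rightarrow> int)) set" where
  "magic_data m = {plain_offset m} \<times> plain_pairs m \<union> split_offsets m \<times> split_pairs m"

lemma magic_data_valid:
  assumes "odd m" "(c, \<alpha>, \<beta>) \<in> magic_data m"
  shows "valid_twice_label m c \<alpha> \<beta>"
    "\<alpha> \<in> extensional (centered m)" "\<beta> \<in> extensional (centered m)"
    "\<forall>d\<in>centered m. \<alpha> (- d) = - \<alpha> d" "\<forall>d\<in>centered m. \<beta> (- d) = - \<beta> d"
    "c = plain_offset m \<or> c \<in> split_offsets m"
proof -
  show "valid_twice_label m c \<alpha> \<beta>"
    using assms(2) unfolding magic_data_def plain_pairs_def split_pairs_def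
    by (elim UnE) (auto intro: valid_plain[OF assms(1)] valid_split[OF assms(1), where c = c])
qed (use assms(2) in \<open>auto simp: magic_data_def plain_pairs_def split_pairs_def
    odd_bijections_def bijections_def PiE_def\<close>)

lemma tile_labeling_in:
  assumes "odd m" "(c, \<alpha>, \<beta>) \<in> magic_data m"
  shows "tile_labeling m c \<alpha> \<beta> \<in> C4_face_magic_labelings m m"
proof -
  obtain p q w where c: "c = (p, q, w)"
    by (cases c)
  note v = magic_data_valid[OF assms]
  have "\<forall>F\<in>proj_C4_faces m m. (\<Sum>x\<in>F. tile_labeling m c \<alpha> \<beta> x) = nat (p + q)"
    using tile_labeling_magic[OF assms(1) v(1)[unfolded c] v(4,5)] c by blast
  moreover have "tile_labeling m c \<alpha> \<beta> \<in> extensional (proj_vertices m m)"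
    by (simp add: tile_labeling_def)
  ultimately show ?thesis
    using bij_betw_tile_labeling[OF assms(1) v(1)]
    unfolding C4_face_magic_labelings_def by blast
qed

text \<open>The label of the central vertex reveals the offsets; the labels on the central
  row and column then reveal the two bijections.\<close>

lemma inj_on_tile_labeling:
  assumes "odd m" "m > 1"
  shows "inj_on (\<lambda>(c, \<alpha>, \<beta>). tile_labeling m c \<alpha> \<beta>) (magic_data m)"
proof (rule inj_onI, clarify)
  fix p q w \<alpha> \<beta> p' q' w' \<alpha>' \<beta>'
  assume d: "((p, q, w), \<alpha>, \<beta>) \<in> magic_data m" and d': "((p', q', w'), \<alpha>', \<beta>') \<in> magic_data m"
    and eq: "tile_labeling m (p, q, w) \<alpha> \<beta> = tile_labeling m (p', q', w') \<alpha>' \<beta>'"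
  let ?D = "centered m"
  note v = magic_data_valid[OF assms(1) d] and v' = magic_data_valid[OF assms(1) d']
  have t: "twice_label (p, q, w) \<alpha> \<beta> x y = twice_label (p', q', w') \<alpha>' \<beta>' x y"
    if x: "x \<in> ?D" and y: "y \<in> ?D" for x y
  proof -
    obtain i where i: "i \<in> {1..m}" "offset m i = x"
      by (rule offset_surj[OF assms(1) x])
    obtain j where j: "j \<in> {1..m}" "offset m j = y"
      by (rule offset_surj[OF assms(1) y])
    show ?thesis
      using twice_tile_labeling[OF assms(1) v(1) i(1) j(1)]
        twice_tile_labeling[OF assms(1) v'(1) i(1) j(1)] eq i j by simp
  qed
  have z: "0 \<in> ?D"
    using assms by (simp add: centered_def)
  hence "\<alpha> 0 = - \<alpha> 0" "\<beta> 0 = - \<beta> 0" "\<alpha>' 0 = - \<alpha>' 0" "\<beta>' 0 = - \<beta>' 0"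
    using v(4,5) v'(4,5) by (metis minus_zero)+
  hence z0: "\<alpha> 0 = 0" "\<beta> 0 = 0" "\<alpha>' 0 = 0" "\<beta>' 0 = 0"
    by linarith+
  have "p = p'"
    using t[OF z z] z0 by (simp add: twice_label_def)
  \<comment> \<open>The possible values of \<open>p\<close> are 2N + 2, N + 2 and 3N + 2, and N > 0
    makes them distinct.\<close>
  moreover note half_range_pos[OF assms]
  ultimately have c: "p' = p" "q' = q" "w' = w" "w \<noteq> 0"
    using v(6) v'(6) by (auto simp: plain_offset_def split_offsets_def)
  have "\<alpha> = \<alpha>'"
  proof (rule extensionalityI[OF v(2) v'(2)])
    fix x
    assume "x \<in> ?D"
    from t[OF this z] show "\<alpha> x = \<alpha>' x"
      using c z0 by (auto simp: twice_label_def split: if_splits)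
  qed
  moreover have "\<beta> = \<beta>'"
  proof (rule extensionalityI[OF v(3) v'(3)])
    fix x
    assume "x \<in> ?D"
    from t[OF z this] show "\<beta> x = \<beta>' x"
      using c z0 by (auto simp: twice_label_def split: if_splits)
  qed
  ultimately show "(p, q, w) = (p', q', w') \<and> (\<alpha>, \<beta>) = (\<alpha>', \<beta>')"
    using c by simp
qed

text \<open>Different tilings contribute disjoint sets of pairs, because a tiling is recovered as
  the images of the two functions. The family \<open>X\<close> stands for all odd bijections or for
  the parity-preserving ones.\<close>

lemma card_UN_tilings_ge:
  assumes "odd m"
    and X: "\<And>A B. (A, B) \<in> symmetric_tilings m \<Longrightarrow>
      X A \<subseteq> odd_bijections (centered m) A \<and> k \<le> card (X A) \<and>
      X B \<subseteq> odd_bijections (centered m) B \<and> k \<le> card (X B)"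
  shows "card (symmetric_tilings m) * k ^ 2 \<le> card (\<Union>(A, B)\<in>symmetric_tilings m. X A \<times> X B)"
    "finite (\<Union>(A, B)\<in>symmetric_tilings m. X A \<times> X B)"
proof -
  let ?T = "symmetric_tilings m"
  have "m > 0"
    using assms(1) by (auto intro: Nat.gr0I)
  hence "finite A \<and> finite B" if "(A, B) \<in> ?T" for A B
    using that by (auto simp: symmetric_tilings_def intro: card_ge_0_finite)
  hence fin: "finite (X A)" "finite (X B)" if "(A, B) \<in> ?T" for A B
    using that X[OF that] finite_odd_bijections[OF finite_centered[of m]]
    by (meson finite_subset)+
  show "finite (\<Union>(A, B)\<in>?T. X A \<times> X B)"
    using fin finite_symmetric_tilings[OF assms(1)] by auto
  have img: "\<alpha> ` centered m = A \<and> \<beta> ` centered m = B"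
    if "(A, B) \<in> ?T" "(\<alpha>, \<beta>) \<in> X A \<times> X B" for A B \<alpha> \<beta>
    using X[OF that(1)] that(2) by (auto simp: odd_bijections_def bijections_def bij_betw_def)
  have "card ?T * k ^ 2 = (\<Sum>(A, B)\<in>?T. k * k)"
    by (simp add: power2_eq_square)
  also have "\<dots> \<le> (\<Sum>(A, B)\<in>?T. card (X A \<times> X B))"
    using X by (intro sum_mono) (auto simp: card_cartesian_product intro!: mult_le_mono)
  also have "\<dots> = card (\<Union>(A, B)\<in>?T. X A \<times> X B)"
  proof (subst card_UN_disjoint)
    show "\<forall>i\<in>?T. \<forall>j\<in>?T. i \<noteq> j \<longrightarrow>
        (case i of (A, B) \<Rightarrow> X A \<times> X B) \<inter> (case j of (A, B) \<Rightarrow> X A \<times> X B) = {}"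
      using img by (clarsimp simp: disjoint_iff) metis
  qed (use fin finite_symmetric_tilings[OF assms(1)] in \<open>auto simp: case_prod_unfold\<close>)
  finally show "card ?T * k ^ 2 \<le> card (\<Union>(A, B)\<in>?T. X A \<times> X B)" .
qed

text \<open>With h = (m - 1)/2, both residues of \<open>m\<close> modulo 4 give the product of the
  factorials of the two rounded halves of h.\<close>

lemma beta_eq:
  assumes "odd m"
  shows "beta m = fact ((m - 1) div 2 div 2) * fact (((m - 1) div 2 + 1) div 2)"
proof -
  have "m mod 4 = 1 \<or> m mod 4 = 3"
    using assms by presburger
  then obtain t where "m = 4 * t + 1 \<or> m = 4 * t + 3"
    by (metis mult.commute mult_div_mod_eq)
  thus ?thesis
    by (auto simp: beta_def power2_eq_square)
qed

lemma card_magic_data_ge: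
  assumes "odd m" "m > 1"
  shows "2 * tau m m * 2 ^ (m - 1) * ((fact ((m - 1) div 2))\<^sup>2 + 2 * (beta m)\<^sup>2) \<le> card (magic_data m)"
    "finite (magic_data m)"
proof -
  define h where "h = (m - 1) div 2"
  let ?T = "symmetric_tilings m" and ?D = "centered m"
  have D: "finite ?D" "symmetric_set ?D" "odd (card ?D)" "\<bar>sum parity_sign ?D\<bar> = 1" "card ?D = m"
    using assms(1) by (simp_all add: finite_centered symmetric_centered sum_parity_sign_centered
        card_centered)
  have T: "finite A" "symmetric_set A" "card A = card ?D" "\<bar>sum parity_sign A\<bar> = 1"
    if "(A, B) \<in> ?T \<or> (B, A) \<in> ?T" for A B
  proof -
    have AB: "(A, B) \<in> ?T"
      using that symmetric_tilings_swap by blast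
    thus "symmetric_set A" "card A = card ?D"
      using D(5) by (simp_all add: symmetric_tilings_def)
    thus "finite A"
      using D(5) assms(2) by (intro card_ge_0_finite) simp
    show "\<bar>sum parity_sign A\<bar> = 1"
      by (rule symmetric_tiling_parity(1)[OF AB assms(1)])
  qed
  have plain: "fact h * 2 ^ h \<le> card (odd_bijections ?D A)" if "(A, B) \<in> ?T \<or> (B, A) \<in> ?T" for A B
    using card_odd_bijections_ge[OF D(1-3) T(1-3)[OF that]] by (simp add: D(5) h_def)
  have split: "beta m * 2 ^ h \<le> card (odd_bijections ?D A \<inter> parity_preserving ?D)"
    if "(A, B) \<in> ?T \<or> (B, A) \<in> ?T" for A B
    using card_parity_odd_bijections_ge[OF D(1-4) T[OF that]] beta_eq[OF assms(1)]
    by (simp add: D(5) h_def)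
  have P: "card ?T * (fact h * 2 ^ h)\<^sup>2 \<le> card (plain_pairs m)" "finite (plain_pairs m)"
    unfolding plain_pairs_def by (rule card_UN_tilings_ge[OF assms(1)]; use plain in blast)+
  have Q: "card ?T * (beta m * 2 ^ h)\<^sup>2 \<le> card (split_pairs m)" "finite (split_pairs m)"
    unfolding split_pairs_def
    by (rule card_UN_tilings_ge[OF assms(1), where X = "\<lambda>A. odd_bijections ?D A \<inter> parity_preserving ?D"];
        use split in blast)+
  note N = half_range_pos[OF assms]
  have fs: "finite (split_offsets m)"
    by (simp add: split_offsets_def)
  show "finite (magic_data m)"
    by (simp add: magic_data_def P(2) Q(2) fs)
  \<comment> \<open>The three offsets are distinct since N > 0; the two split ones produce the
    coefficient 2 of the squared \<open>beta m\<close>.\<close>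
  have "plain_offset m \<notin> split_offsets m" "card (split_offsets m) = 2"
    using N by (simp_all add: plain_offset_def split_offsets_def)
  hence card: "card (magic_data m) = card (plain_pairs m) + 2 * card (split_pairs m)"
    unfolding magic_data_def using P(2) Q(2) fs
    by (subst card_Un_disjoint) (auto simp: card_cartesian_product)
  \<comment> \<open>The sign choices for the two functions contribute a factor \<open>2 ^ h\<close>
    each, together \<open>2 ^ (m - 1)\<close>.\<close>
  have "m - 1 = h * 2"
    using assms(1) by (simp add: h_def)
  hence "(2 :: nat) ^ (m - 1) = (2 ^ h)\<^sup>2"
    by (simp add: power_mult)
  hence "2 * tau m m * 2 ^ (m - 1) * ((fact h)\<^sup>2 + 2 * (beta m)\<^sup>2)
      = 2 * tau m m * ((fact h * 2 ^ h)\<^sup>2 + 2 * (beta m * 2 ^ h)\<^sup>2)"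
    by (simp add: power_mult_distrib algebra_simps)
  also have "\<dots> \<le> card ?T * ((fact h * 2 ^ h)\<^sup>2 + 2 * (beta m * 2 ^ h)\<^sup>2)"
    by (intro mult_le_mono1 card_symmetric_tilings_ge assms)
  also have "\<dots> \<le> card (magic_data m)"
    using P(1) Q(1) by (simp add: card algebra_simps)
  finally show "2 * tau m m * 2 ^ (m - 1) * ((fact ((m - 1) div 2))\<^sup>2 + 2 * (beta m)\<^sup>2)
      \<le> card (magic_data m)"
    by (simp add: h_def)
qed

theorem theorem45:
  fixes m :: nat
  assumes "m \<ge> 3" and "odd m"
  shows "num_labelings_up_to_symmetry m \<ge>
           tau m m * 2 ^ (m - 3) * ((fact ((m - 1) div 2))\<^sup>2 + 2 * (beta m)\<^sup>2)"
proof -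
  let ?f = "\<lambda>(c, \<alpha>, \<beta>). tile_labeling m c \<alpha> \<beta>"
  have m: "m > 1"
    using assms by simp
  \<comment> \<open>Dividing by 8 absorbs the factor 2 from exchanging the tiles and lowers the
    exponent by two; \<open>m \<ge> 3\<close> keeps the truncated subtraction exact.\<close>
  have "m - 1 = Suc (Suc (m - 3))"
    using assms(1) by simp
  hence "8 * (tau m m * 2 ^ (m - 3) * ((fact ((m - 1) div 2))\<^sup>2 + 2 * (beta m)\<^sup>2))
      = 2 * tau m m * 2 ^ (m - 1) * ((fact ((m - 1) div 2))\<^sup>2 + 2 * (beta m)\<^sup>2)"
    by simp
  also have "\<dots> \<le> card (magic_data m)"
    by (rule card_magic_data_ge[OF assms(2) m])
  also have "\<dots> = card (?f ` magic_data m)"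
    by (rule card_image[OF inj_on_tile_labeling[OF assms(2) m], symmetric])
  also have "\<dots> \<le> card (C4_face_magic_labelings m m)"
    using tile_labeling_in[OF assms(2)]
    by (intro card_mono finite_C4_face_magic_labelings) auto
  also have "\<dots> \<le> 8 * num_labelings_up_to_symmetry m"
    by (rule card_labelings_le)
  finally show ?thesis
    by simp
qed

end
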